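(* Let $n\ge3$ be an integer and write $n=2^p+m$ with integers $p\ge 0$ and $0<m\le 2^p$. The first three Betti numbers of the Lie algebra $\mathfrak{m}_0(n)$ over $\mathbb{Z}_2$ are: (a) $b_1(\mathfrak{m}_0(n))=2$; (b) $b_2(\mathfrak{m}_0(n))=\lfloor\frac12(n+1)\rfloor$; (c) $b_3(\mathfrak{m}_0(n))=\frac13(2^p-1)(2^{p-1}-1)+\frac12m(m-1)+\lfloor\frac12(n-1)\rfloor$.
   Context: $\mathfrak{m}_0(n)$ is the Lie algebra over $\mathbb{Z}_2$ with basis $e_1,\dots,e_n$ and brackets $[e_1,e_i]=e_{i+1}$ for $1<i<n$, all other brackets of basis elements (not following by antisymmetry) being zero. For a finite-dimensional Lie algebra $\mathfrak{g}$, $b_q(\mathfrak{g})=\dim H^q(\mathfrak{g})$, where $H^q(\mathfrak{g})$ is the Lie algebra cohomology with trivial coefficients $\mathbb{Z}_2$: with $e^i$ the dual basis and $\Lambda^q(\mathfrak{g})$ the space of $q$-forms spanned by monomials $e^{i_1}\wedge\dots\wedge e^{i_q}$, the differential is $d\xi(X,Y)=\xi([X,Y])$ on one-forms, extended as a derivation of the exterior algebra, and $H^q(\mathfrak{g})=\ker(d:\Lambda^q\to\Lambda^{q+1})/\mathrm{Im}(d:\Lambda^{q-1}\to\Lambda^q)$. Here $de^1=de^2=0$ and $de^i=e^1\wedge e^{i-1}$ for $3\le i\le n$. $\lfloor\cdot\rfloor$ denotes the integer part. *)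

theory Defs
  imports "HOL-Algebra.AbelCoset" "Jordan_Normal_Form.VS_Connect" "HOL-Library.Z2" Complex_Main
begin

text \<open>
  The field with two elements is the type \<^typ>\<open>bit\<close>; as an algebraic structure with explicit
  carrier it is \<^term>\<open>class_ring :: bit ring\<close>. An \<open>n\<close>-dimensional Lie algebra with a chosen basis
  \<open>e\<^sub>1, \<dots>, e\<^sub>n\<close> is given by its bracket on coordinate vectors, that is, on the functions
  \<^typ>\<open>nat \<Rightarrow> bit\<close> supported in \<open>{1..n}\<close>.
\<close>

type_synonym vec2 = "nat \<Rightarrow> bit"

definition vectors :: "nat \<Rightarrow> vec2 set" where
  "vectors n = {X. \<forall>i. X i \<noteq> 0 \<longrightarrow> i \<in> {1..n}}"

definition basis_vec :: "nat \<Rightarrow> vec2" where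
  "basis_vec i = (\<lambda>k. of_bool (k = i))"

definition lie_algebra :: "nat \<Rightarrow> (vec2 \<Rightarrow> vec2 \<Rightarrow> vec2) \<Rightarrow> bool" where
  "lie_algebra n br \<longleftrightarrow>
     (\<forall>X\<in>vectors n. \<forall>Y\<in>vectors n. br X Y \<in> vectors n) \<and>
     (\<forall>a. \<forall>X\<in>vectors n. \<forall>Y\<in>vectors n. \<forall>Z\<in>vectors n.
        br (\<lambda>k. a * X k + Y k) Z = (\<lambda>k. a * br X Z k + br Y Z k) \<and>
        br Z (\<lambda>k. a * X k + Y k) = (\<lambda>k. a * br Z X k + br Z Y k)) \<and>
     (\<forall>X\<in>vectors n. br X X = (\<lambda>k. 0)) \<and>
     (\<forall>X\<in>vectors n. \<forall>Y\<in>vectors n. \<forall>Z\<in>vectors n.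
        (\<lambda>k. br X (br Y Z) k + br Y (br Z X) k + br Z (br X Y) k) = (\<lambda>k. 0))"

definition m0_basis_bracket :: "nat \<Rightarrow> nat \<Rightarrow> nat \<Rightarrow> vec2" where
  "m0_basis_bracket n i j =
     (if i = 1 \<and> 1 < j \<and> j < n then basis_vec (j + 1)
      else if j = 1 \<and> 1 < i \<and> i < n then (\<lambda>k. - basis_vec (i + 1) k)
      else (\<lambda>k. 0))"

definition m0_bracket :: "nat \<Rightarrow> vec2 \<Rightarrow> vec2 \<Rightarrow> vec2" where
  "m0_bracket n X Y =
     (\<lambda>k. \<Sum>i\<in>{1..n}. \<Sum>j\<in>{1..n}. X i * Y j * m0_basis_bracket n i j k)"

text \<open>
  A form is the family of its coefficients with respect to the monomials
  \<open>e\<^sup>I\<close>, the product of the \<open>e\<^sup>i\<close> over \<open>i \<in> I\<close> in increasing order. In characteristic 2 no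
  signs occur: \<open>e\<^sup>I \<and> e\<^sup>J\<close> is the monomial of \<open>I \<union> J\<close> if \<open>I\<close> and \<open>J\<close> are disjoint, and 0
  otherwise (see \<open>wedge_monomial_form\<close> below).
\<close>

type_synonym form = "nat set \<Rightarrow> bit"

definition monomial_form :: "nat set \<Rightarrow> form" where
  "monomial_form I = (\<lambda>J. of_bool (J = I))"

definition wedge :: "form \<Rightarrow> form \<Rightarrow> form" where
  "wedge \<alpha> \<beta> = (\<lambda>I. \<Sum>J\<in>Pow I. \<alpha> J * \<beta> (I - J))"

definition form_space :: "nat \<Rightarrow> nat \<Rightarrow> (bit, form) module" where
  "form_space n q =
     \<lparr> carrier = {\<omega>. \<forall>I. \<omega> I \<noteq> 0 \<longrightarrow> I \<subseteq> {1..n} \<and> card I = q},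
       mult = undefined, one = undefined,
       zero = (\<lambda>I. 0), add = (\<lambda>\<alpha> \<beta> I. \<alpha> I + \<beta> I),
       smult = (\<lambda>a \<omega> I. a * \<omega> I) \<rparr>"

definition eval1 :: "nat \<Rightarrow> form \<Rightarrow> vec2 \<Rightarrow> bit" where
  "eval1 n \<xi> X = (\<Sum>i\<in>{1..n}. \<xi> {i} * X i)"

definition eval2 :: "nat \<Rightarrow> form \<Rightarrow> vec2 \<Rightarrow> vec2 \<Rightarrow> bit" where
  "eval2 n \<omega> X Y = (\<Sum>j\<in>{1..n}. \<Sum>i\<in>{1..<j}. \<omega> {i, j} * (X i * Y j - X j * Y i))"

text \<open>
  The differential of a one-form \<open>\<xi>\<close> is the two-form \<open>d\<xi>\<close> with \<open>d\<xi>(X, Y) = \<xi>([X, Y])\<close>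
  (see \<open>eval2_d_one\<close> below); its coefficient at \<open>e\<^sup>i \<and> e\<^sup>j\<close>, \<open>i < j\<close>, is \<open>\<xi>([e\<^sub>i, e\<^sub>j])\<close>.
\<close>

definition d_one :: "nat \<Rightarrow> (vec2 \<Rightarrow> vec2 \<Rightarrow> vec2) \<Rightarrow> form \<Rightarrow> form" where
  "d_one n br \<xi> = (\<lambda>I. if I \<subseteq> {1..n} \<and> card I = 2
     then eval1 n \<xi> (br (basis_vec (Min I)) (basis_vec (Max I))) else 0)"

text \<open>
  The extension as a derivation: \<open>d(e\<^sup>I)\<close> is the sum over \<open>i \<in> I\<close> of \<open>de\<^sup>i \<and> e\<^sup>J\<close>
  with \<open>J = I - {i}\<close> (Leibniz rule, no signs in characteristic 2), extended linearly.
\<close>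

definition d_form :: "nat \<Rightarrow> (vec2 \<Rightarrow> vec2 \<Rightarrow> vec2) \<Rightarrow> form \<Rightarrow> form" where
  "d_form n br \<omega> = (\<lambda>K. \<Sum>I\<in>Pow {1..n}. \<omega> I *
     (\<Sum>i\<in>I. wedge (d_one n br (monomial_form {i})) (monomial_form (I - {i})) K))"

definition cocycles :: "nat \<Rightarrow> (vec2 \<Rightarrow> vec2 \<Rightarrow> vec2) \<Rightarrow> nat \<Rightarrow> form set" where
  "cocycles n br q = {\<omega> \<in> carrier (form_space n q). d_form n br \<omega> = (\<lambda>I. 0)}"

definition coboundaries :: "nat \<Rightarrow> (vec2 \<Rightarrow> vec2 \<Rightarrow> vec2) \<Rightarrow> nat \<Rightarrow> form set" where
  "coboundaries n br q =
     (if q = 0 then {\<lambda>I. 0} else d_form n br ` carrier (form_space n (q - 1)))"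

definition quotient_module :: "('a, 'b, 'c) module_scheme \<Rightarrow> 'b set \<Rightarrow> ('a, 'b set) module" where
  "quotient_module M W =
     \<lparr> carrier = a_rcosets\<^bsub>M\<^esub> W,
       mult = undefined, one = undefined,
       zero = W, add = set_add M,
       smult = (\<lambda>a C. \<Union>x\<in>C. W +>\<^bsub>M\<^esub> (a \<odot>\<^bsub>M\<^esub> x)) \<rparr>"

definition cohomology :: "nat \<Rightarrow> (vec2 \<Rightarrow> vec2 \<Rightarrow> vec2) \<Rightarrow> nat \<Rightarrow> (bit, form set) module" where
  "cohomology n br q =
     quotient_module ((form_space n q)\<lparr>carrier := cocycles n br q\<rparr>) (coboundaries n br q)"

definition betti :: "nat \<Rightarrow> (vec2 \<Rightarrow> vec2 \<Rightarrow> vec2) \<Rightarrow> nat \<Rightarrow> nat" where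
  "betti n br q = vectorspace.dim (class_ring :: bit ring) (cohomology n br q)"

declare add_bit_eq_xor [simp del] mult_bit_eq_and [simp del]

lemma m0_bracket_eq:
  "m0_bracket n X Y =
    (\<lambda>k. if 3 \<le> k \<and> k \<le> n then X 1 * Y (k - 1) + X (k - 1) * Y 1 else 0)"
proof
  fix k
  have split: "m0_basis_bracket n i j k =
      (if i = 1 \<and> 1 < j \<and> j < n \<and> k = j + 1 then 1 else 0) +
      (if j = 1 \<and> 1 < i \<and> i < n \<and> k = i + 1 then 1 else 0)" for i j
    by (auto simp: m0_basis_bracket_def basis_vec_def)
  have "m0_bracket n X Y k =
      (\<Sum>i\<in>{1..n}. \<Sum>j\<in>{1..n}. if i = 1 then if j = k - 1 then
         (if 3 \<le> k \<and> k \<le> n then X 1 * Y (k - 1) else 0) else 0 else 0) +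
      (\<Sum>i\<in>{1..n}. \<Sum>j\<in>{1..n}. if i = k - 1 then if j = 1 then
         (if 3 \<le> k \<and> k \<le> n then X (k - 1) * Y 1 else 0) else 0 else 0)"
    unfolding m0_bracket_def split sum.distrib[symmetric]
    by (intro sum.cong refl) auto
  also have "\<dots> = (if 3 \<le> k \<and> k \<le> n then X 1 * Y (k - 1) + X (k - 1) * Y 1 else 0)"
  proof -
    have inner: "(\<Sum>j\<in>{1..n}. if P then if j = a then c else 0 else 0)
        = (if P then if a \<in> {1..n} then c else 0 else (0::bit))" for P a c
      by simp
    show ?thesis
      unfolding inner by (cases "3 \<le> k \<and> k \<le> n") auto
  qed
  finally show "m0_bracket n X Y k =
      (if 3 \<le> k \<and> k \<le> n then X 1 * Y (k - 1) + X (k - 1) * Y 1 else 0)" .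
qed

lemma lie_algebra_m0: "lie_algebra n (m0_bracket n)"
proof -
  have cancel: "x + x = (0::bit)" for x
    by (cases x) auto
  have closed: "m0_bracket n X Y \<in> vectors n" for X Y
    by (auto simp: m0_bracket_eq vectors_def)
  have lin1: "m0_bracket n (\<lambda>k. a * X k + Y k) Z = (\<lambda>k. a * m0_bracket n X Z k + m0_bracket n Y Z k)"
    for a X Y Z
  proof
    fix k
    have "(a * X 1 + Y 1) * Z (k - 1) + (a * X (k - 1) + Y (k - 1)) * Z 1 =
        a * (X 1 * Z (k - 1) + X (k - 1) * Z 1) + (Y 1 * Z (k - 1) + Y (k - 1) * Z 1)"
      by (simp only: distrib_left distrib_right ac_simps)
    then show "m0_bracket n (\<lambda>k. a * X k + Y k) Z k = a * m0_bracket n X Z k + m0_bracket n Y Z k"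
      by (simp add: m0_bracket_eq)
  qed
  have comm: "m0_bracket n X Y = m0_bracket n Y X" for X Y
    unfolding m0_bracket_eq by (simp only: ac_simps)
  have lin2: "m0_bracket n Z (\<lambda>k. a * X k + Y k) = (\<lambda>k. a * m0_bracket n Z X k + m0_bracket n Z Y k)"
    for a X Y Z
    by (subst (1 2 3) comm) (rule lin1)
  have alt: "m0_bracket n X X = (\<lambda>k. 0)" for X
    unfolding m0_bracket_eq by (simp only: mult.commute[of "X 1"] cancel if_cancel)
  have first: "m0_bracket n X Y 1 = 0" for X Y
    by (simp add: m0_bracket_eq)
  have jacobi: "m0_bracket n X (m0_bracket n Y Z) k + m0_bracket n Y (m0_bracket n Z X) k +
      m0_bracket n Z (m0_bracket n X Y) k = 0" for X Y Z k
  proof -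
    have step: "m0_bracket n X (m0_bracket n Y Z) k =
        (if 4 \<le> k \<and> k \<le> n then X 1 * Y 1 * Z (k - 2) + X 1 * Z 1 * Y (k - 2) else 0)" for X Y Z
    proof (cases "4 \<le> k \<and> k \<le> n")
      case True
      then have "3 \<le> k" "3 \<le> k - 1" "k - 1 \<le> n" "k - 1 - 1 = k - 2"
        by auto
      have "m0_bracket n Y Z (k - 1) = Y 1 * Z (k - 2) + Y (k - 2) * Z 1"
        using \<open>3 \<le> k - 1\<close> \<open>k - 1 \<le> n\<close> \<open>k - 1 - 1 = k - 2\<close>
        by (simp only: m0_bracket_eq if_True simp_thms)
      moreover have "m0_bracket n X (m0_bracket n Y Z) k = X 1 * m0_bracket n Y Z (k - 1)"
        using True \<open>3 \<le> k\<close> first[of Y Z]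
        by (subst m0_bracket_eq) (simp only: if_True simp_thms mult_zero_right add_0_right)
      ultimately show ?thesis
        using True by (simp only: if_True simp_thms distrib_left ac_simps)
    next
      case False
      have "m0_bracket n Y Z (k - 1) = 0" if "3 \<le> k" "k \<le> n"
      proof -
        have "\<not> 3 \<le> k - 1"
          using that False by auto
        then show ?thesis
          by (simp only: m0_bracket_eq simp_thms if_False)
      qed
      then have "m0_bracket n X (m0_bracket n Y Z) k = 0"
        using first[of Y Z]
        by (cases "3 \<le> k \<and> k \<le> n") (auto simp: m0_bracket_eq[of n X])
      then show ?thesis
        using False by (simp only: if_False)
    qed
    have six: "(a + b) + (c + a) + (b + c) = 0" for a b c :: bit
      by (cases a; cases b; cases c) auto
    show ?thesis
    proof (cases "4 \<le> k \<and> k \<le> n")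
      case True
      then show ?thesis
        using six[of "X 1 * Y 1 * Z (k - 2)" "X 1 * Z 1 * Y (k - 2)" "Y 1 * Z 1 * X (k - 2)"]
        by (simp only: step if_True simp_thms ac_simps)
    next
      case False
      then show ?thesis
        by (simp only: step if_False add_0_right)
    qed
  qed
  show ?thesis
    unfolding lie_algebra_def using closed lin1 lin2 alt jacobi by blast
qed

lemma eval2_d_one:
  assumes "lie_algebra n br" "X \<in> vectors n" "Y \<in> vectors n"
  shows "eval2 n (d_one n br \<xi>) X Y = eval1 n \<xi> (br X Y)"
proof -
  have cancel: "x + x = (0::bit)" for x
    by (cases x) auto
  have lin: "f X = (\<Sum>i\<in>{1..n}. X i * f (basis_vec i))"
    if f: "\<And>a X Y. X \<in> vectors n \<Longrightarrow> Y \<in> vectors n \<Longrightarrow> f (\<lambda>k. a * X k + Y k) = a * f X + f Y"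
      and X: "X \<in> vectors n" for f :: "vec2 \<Rightarrow> bit" and X
  proof -
    have z: "(\<lambda>k. 0) \<in> vectors n"
      by (simp add: vectors_def)
    have "f (\<lambda>k. \<Sum>i\<in>A. X i * basis_vec i k) = (\<Sum>i\<in>A. X i * f (basis_vec i))"
      if "finite A" "A \<subseteq> {1..n}" for A
      using that
    proof (induction A)
      case empty
      show ?case
        using f[OF z z, of 1] cancel by simp
    next
      case (insert i A)
      have "(\<lambda>k. \<Sum>j\<in>A. X j * basis_vec j k) \<in> vectors n"
        unfolding vectors_def
      proof (intro CollectI allI impI)
        fix k assume "(\<Sum>j\<in>A. X j * basis_vec j k) \<noteq> 0"
        then obtain j where "j \<in> A" "X j * basis_vec j k \<noteq> 0"
          by (rule sum.not_neutral_contains_not_neutral)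
        then show "k \<in> {1..n}"
          using insert.prems by (auto simp: basis_vec_def split: if_splits)
      qed
      moreover have "basis_vec i \<in> vectors n"
        using insert.prems by (auto simp: vectors_def basis_vec_def)
      ultimately have "f (\<lambda>k. X i * basis_vec i k + (\<Sum>j\<in>A. X j * basis_vec j k)) =
          X i * f (basis_vec i) + f (\<lambda>k. \<Sum>j\<in>A. X j * basis_vec j k)"
        by (intro f)
      moreover have "A \<subseteq> {1..n}"
        using insert.prems by simp
      ultimately show ?case
        using insert.IH by (simp only: sum.insert[OF insert.hyps])
    qed
    from this[of "{1..n}"] have
      "f (\<lambda>k. \<Sum>i\<in>{1..n}. X i * basis_vec i k) = (\<Sum>i\<in>{1..n}. X i * f (basis_vec i))"
      by simp
    moreover have "(\<lambda>k. \<Sum>i\<in>{1..n}. X i * basis_vec i k) = X"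
    proof
      fix k
      have "(\<Sum>i\<in>{1..n}. X i * basis_vec i k) = (\<Sum>i\<in>{1..n}. if i = k then X k else 0)"
        by (intro sum.cong) (auto simp: basis_vec_def)
      also have "\<dots> = X k"
        using X by (auto simp: vectors_def)
      finally show "(\<Sum>i\<in>{1..n}. X i * basis_vec i k) = X k" .
    qed
    ultimately show ?thesis by simp
  qed
  define B where "B X Y = eval1 n \<xi> (br X Y)" for X Y
  define b where "b i j = B (basis_vec i) (basis_vec j)" for i j
  have ev: "eval1 n \<xi> (\<lambda>k. a * X k + Y k) = a * eval1 n \<xi> X + eval1 n \<xi> Y" for a X Y
    by (simp only: eval1_def distrib_left sum.distrib sum_distrib_left mult.left_commute)
  have e: "basis_vec i \<in> vectors n" if "i \<in> {1..n}" for i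
    using that by (auto simp: vectors_def basis_vec_def)
  have B1: "B (\<lambda>k. a * X k + Y k) Z = a * B X Z + B Y Z"
    and B2: "B Z (\<lambda>k. a * X k + Y k) = a * B Z X + B Z Y"
    if "X \<in> vectors n" "Y \<in> vectors n" "Z \<in> vectors n" for a X Y Z
  proof -
    have "br (\<lambda>k. a * X k + Y k) Z = (\<lambda>k. a * br X Z k + br Y Z k)"
      and "br Z (\<lambda>k. a * X k + Y k) = (\<lambda>k. a * br Z X k + br Z Y k)"
      using assms(1) that unfolding lie_algebra_def by blast+
    then show "B (\<lambda>k. a * X k + Y k) Z = a * B X Z + B Y Z"
      and "B Z (\<lambda>k. a * X k + Y k) = a * B Z X + B Z Y"
      by (simp_all only: B_def ev)
  qed
  have B0: "B Z Z = 0" if "Z \<in> vectors n" for Z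
    using assms(1) that by (simp add: lie_algebra_def B_def eval1_def)
  have diag: "b i i = 0" if "i \<in> {1..n}" for i
    using B0 e that by (simp add: b_def)
  have skew: "b j i = b i j" if "i \<in> {1..n}" "j \<in> {1..n}" for i j
  proof -
    let ?s = "\<lambda>k. 1 * basis_vec i k + basis_vec j k"
    have s: "?s \<in> vectors n"
      using that by (auto simp: vectors_def basis_vec_def split: if_splits)
    have "0 = B ?s ?s"
      using B0[OF s] by simp
    also have "\<dots> = B (basis_vec i) ?s + B (basis_vec j) ?s"
      using B1[OF e[OF that(1)] e[OF that(2)] s, of 1] by simp
    also have "\<dots> = b i j + b j i"
      using B2[OF e[OF that(1)] e[OF that(2)] e[OF that(1)], of 1]
        B2[OF e[OF that(1)] e[OF that(2)] e[OF that(2)], of 1] diag that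
      by (simp add: b_def)
    finally show ?thesis
      by (cases "b i j"; cases "b j i") auto
  qed
  have d: "d_one n br \<xi> {i, j} = b i j" if "i < j" "i \<in> {1..n}" "j \<in> {1..n}" for i j
    using that by (simp add: d_one_def b_def B_def min_def max_def)
  have "B X Y = (\<Sum>j\<in>{1..n}. Y j * B X (basis_vec j))"
    using B2 assms lin[of "B X" Y] by blast
  also have "\<dots> = (\<Sum>j\<in>{1..n}. \<Sum>i\<in>{1..n}. X i * Y j * b i j)"
  proof (intro sum.cong refl)
    fix j assume j: "j \<in> {1..n}"
    have "B X (basis_vec j) = (\<Sum>i\<in>{1..n}. X i * b i j)"
      using lin[of "\<lambda>X. B X (basis_vec j)" X] B1 e[OF j] assms by (simp add: b_def)
    then show "Y j * B X (basis_vec j) = (\<Sum>i\<in>{1..n}. X i * Y j * b i j)"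
      by (simp only: sum_distrib_left mult_ac)
  qed
  also have "\<dots> = (\<Sum>j\<in>{1..n}. (\<Sum>i\<in>{1..<j}. X i * Y j * b i j) + (\<Sum>i\<in>{j<..n}. X i * Y j * b i j))"
  proof (intro sum.cong refl)
    fix j assume j: "j \<in> {1..n}"
    then have "{1..n} = insert j ({1..<j} \<union> {j<..n})"
      by auto
    then have "(\<Sum>i\<in>{1..n}. X i * Y j * b i j) =
        (\<Sum>i\<in>insert j ({1..<j} \<union> {j<..n}). X i * Y j * b i j)"
      by simp
    also have "\<dots> = (\<Sum>i\<in>{1..<j} \<union> {j<..n}. X i * Y j * b i j)"
      using diag[OF j] by simp
    also have "\<dots> = (\<Sum>i\<in>{1..<j}. X i * Y j * b i j) + (\<Sum>i\<in>{j<..n}. X i * Y j * b i j)"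
      by (rule sum.union_disjoint) auto
    finally show "(\<Sum>i\<in>{1..n}. X i * Y j * b i j) =
        (\<Sum>i\<in>{1..<j}. X i * Y j * b i j) + (\<Sum>i\<in>{j<..n}. X i * Y j * b i j)" .
  qed
  also have "\<dots> = (\<Sum>j\<in>{1..n}. \<Sum>i\<in>{1..<j}. X i * Y j * b i j) +
      (\<Sum>j\<in>{1..n}. \<Sum>i\<in>{j<..n}. X i * Y j * b i j)"
    by (rule sum.distrib)
  also have "(\<Sum>j\<in>{1..n}. \<Sum>i\<in>{j<..n}. X i * Y j * b i j) =
      (\<Sum>i\<in>{1..n}. \<Sum>j\<in>{1..<i}. X i * Y j * b i j)"
    unfolding sum.Sigma[OF finite_atLeastAtMost ballI[OF finite_greaterThanAtMost]]
      sum.Sigma[OF finite_atLeastAtMost ballI[OF finite_atLeastLessThan]]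
    by (rule sum.reindex_bij_witness[of _ prod.swap prod.swap]) auto
  also have "(\<Sum>j\<in>{1..n}. \<Sum>i\<in>{1..<j}. X i * Y j * b i j) + \<dots> =
      eval2 n (d_one n br \<xi>) X Y"
    unfolding eval2_def sum.distrib[symmetric]
    by (intro sum.cong refl) (auto simp: d skew algebra_simps)
  finally show ?thesis
    by (simp add: B_def)
qed

lemma d_form_monomial:
  assumes "I \<subseteq> {1..n}"
  shows "d_form n br (monomial_form I) =
    (\<lambda>K. \<Sum>i\<in>I. wedge (d_one n br (monomial_form {i})) (monomial_form (I - {i})) K)"
proof
  fix K
  let ?f = "\<lambda>I. \<Sum>i\<in>I. wedge (d_one n br (monomial_form {i})) (monomial_form (I - {i})) K"
  have "d_form n br (monomial_form I) K = (\<Sum>J\<in>Pow {1..n}. if J = I then ?f I else 0)"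
    unfolding d_form_def by (intro sum.cong) (auto simp: monomial_form_def)
  then show "d_form n br (monomial_form I) K = ?f I"
    using assms by simp
qed

lemma wedge_monomial_form:
  assumes "finite I" "finite J"
  shows "wedge (monomial_form I) (monomial_form J) =
    (if I \<inter> J = {} then monomial_form (I \<union> J) else (\<lambda>K. 0))"
proof
  fix K
  show "wedge (monomial_form I) (monomial_form J) K =
    (if I \<inter> J = {} then monomial_form (I \<union> J) else (\<lambda>K. 0)) K"
  proof (cases "finite K")
    case True
    have "wedge (monomial_form I) (monomial_form J) K =
        (\<Sum>L\<in>Pow K. if L = I then of_bool (K - I = J) else 0)"
      unfolding wedge_def by (intro sum.cong) (auto simp: monomial_form_def)
    also have "\<dots> = of_bool (I \<subseteq> K \<and> K - I = J)"
      using True by auto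
    also have "\<dots> = (if I \<inter> J = {} then monomial_form (I \<union> J) else (\<lambda>K. 0)) K"
      by (auto simp: monomial_form_def)
    finally show ?thesis .
  next
    case False
    then show ?thesis
      using assms by (auto simp: wedge_def monomial_form_def)
  qed
qed

lemma d_m0_generators:
  assumes "i \<in> {1..n}"
  shows "d_form n (m0_bracket n) (monomial_form {i}) =
    (if i \<le> 2 then (\<lambda>I. 0) else wedge (monomial_form {1}) (monomial_form {i - 1}))"
proof -
  have ev: "eval1 n (monomial_form {i}) X = X i" for X
  proof -
    have "eval1 n (monomial_form {i}) X = (\<Sum>j\<in>{1..n}. if j = i then X i else 0)"
      unfolding eval1_def by (intro sum.cong) (auto simp: monomial_form_def)
    then show ?thesis
      using assms by simp
  qed
  have one: "d_one n (m0_bracket n) (monomial_form {i}) =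
      (if i \<le> 2 then (\<lambda>I. 0) else monomial_form {1, i - 1})" (is "?L = ?R")
  proof
    fix I
    show "?L I = ?R I"
    proof (cases "I \<subseteq> {1..n} \<and> card I = 2")
      case True
      then obtain a b where ab: "I = {a, b}" "a < b" "a \<in> {1..n}" "b \<in> {1..n}"
        by (metis card_2_iff insert_commute insert_subset linorder_neqE_nat)
      then have "?L I = m0_bracket n (basis_vec a) (basis_vec b) i"
        by (simp add: d_one_def ev min_def max_def)
      also have "\<dots> = ?R I"
        using ab assms
        by (auto simp: m0_bracket_eq basis_vec_def monomial_form_def doubleton_eq_iff)
      finally show ?thesis .
    next
      case False
      moreover have "{1, i - 1} \<subseteq> {1..n} \<and> card {1, i - 1} = 2" if "\<not> i \<le> 2"
        using that assms by (auto simp: card_2_iff)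
      ultimately show ?thesis
        by (auto simp: d_one_def monomial_form_def)
    qed
  qed
  have "d_form n (m0_bracket n) (monomial_form {i}) =
      wedge (d_one n (m0_bracket n) (monomial_form {i})) (monomial_form {})"
  proof -
    have "{i} \<subseteq> {1..n}"
      using assms by simp
    then show ?thesis
      by (simp only: d_form_monomial sum.insert[OF finite.emptyI] empty_iff not_False_eq_True
          sum.empty add_0_right Diff_cancel)
  qed
  also have "\<dots> = (if i \<le> 2 then (\<lambda>I. 0) else monomial_form {1, i - 1})"
    by (simp add: one wedge_monomial_form) (simp add: wedge_def)
  also have "\<dots> = (if i \<le> 2 then (\<lambda>I. 0) else wedge (monomial_form {1}) (monomial_form {i - 1}))"
    by (auto simp: wedge_monomial_form insert_commute)
  finally show ?thesis .
qed

end

theory Submission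
  imports Defs
begin

text \<open>
  Let \<open>D\<close> be the derivation of the exterior algebra of \<open>\<langle>e\<^sup>2, \<dots>, e\<^sup>n\<rangle>\<close> with \<open>D e\<^sup>2 = 0\<close> and
  \<open>D e\<^bsup>i+1\<^esup> = e\<^sup>i\<close>. As \<open>d \<omega> = e\<^sup>1 \<and> D \<omega>\<close>, the number \<open>b\<^sub>q\<close> is \<open>k\<^sub>q + k\<^bsub>q-1\<^esub>\<close>, where \<open>k\<^sub>q\<close> is the
  dimension of the kernel of \<open>D\<close> on \<open>q\<close>-forms. The values of \<open>k\<^sub>0\<close>, \<open>k\<^sub>1\<close>, \<open>k\<^sub>2\<close> are immediate.

  For \<open>k\<^sub>3\<close> put \<open>v\<^sub>i = e\<^bsup>i+2\<^esup>\<close> and pass from the span of \<open>v\<^sub>0, \<dots>, v\<^bsub>N-1\<^esub>\<close> to that of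
  \<open>v\<^sub>0, \<dots>, v\<^sub>N\<close>. A new kernel element is \<open>v\<^sub>N \<and> \<alpha> + \<beta>\<close> with \<open>D \<alpha> = 0\<close>, so \<open>\<alpha>\<close> is a combination
  of the forms \<open>\<alpha>\<^sub>s\<close>, the sum of \<open>v\<^sub>i \<and> v\<^sub>j\<close> over \<open>i < j\<close>, \<open>i + j = s\<close>, with \<open>s\<close> odd. If
  \<open>N + 1 = 2\<^sup>p + m\<close> with \<open>0 \<le> m < 2\<^sup>p\<close>, exactly the \<open>s < 2m\<close> occur, so that \<open>k\<^sub>3\<close> grows by \<open>m\<close>.
  They do occur: the multinomial coefficients of \<open>2\<^bsup>p+1\<^esup> - 1\<close> modulo 2 give a kernel element with
  \<open>s = 2m - 1\<close>, and an operator commuting with \<open>D\<close> lowers \<open>s\<close> by 2. Conversely that operator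
  reduces a larger \<open>s\<close> to \<open>s = 2m + 1\<close>, which is impossible since the coefficient of a kernel
  element at \<open>v\<^sub>m \<and> v\<^bsub>m+1\<^esub> \<and> v\<^bsub>m+2\<^sup>p-1\<^esub>\<close> always vanishes.

  All dimensions are obtained by counting: a space of dimension \<open>k\<close> has \<open>2\<^sup>k\<close> elements.
\<close>

section \<open>Spaces over the field with two elements\<close>

text \<open>Coordinates with respect to a basis \<open>A\<close> identify the carrier with
  \<open>A \<rightarrow>\<^sub>E carrier K\<close>. A finite carrier is its own finite spanning set,
  so a finite basis exists.\<close>

lemma (in vectorspace) card_carrier_eq_power_dim:
  assumes "finite (carrier V)"
  shows "card (carrier V) = card (carrier K) ^ dim"
proof -
  have "fin_dim"
    unfolding fin_dim_def using assms in_own_span[of "carrier V"] span_is_subset2[of "carrier V"]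
    by (intro exI[of _ "carrier V"]) auto
  then obtain A where A: "finite A" "basis A"
    using finite_basis_exists by blast
  then have AV: "A \<subseteq> carrier V"
    by (simp add: basis_def)
  have rep: "\<forall>v\<in>carrier V. \<exists>!a. a \<in> A \<rightarrow>\<^sub>E carrier K \<and> lincomb a A = v"
    using basis_criterion[OF A(1) AV] A(2) by blast
  have "bij_betw (\<lambda>a. lincomb a A) (A \<rightarrow>\<^sub>E carrier K) (carrier V)"
  proof (rule bij_betw_imageI)
    have cl: "lincomb a A \<in> carrier V" if "a \<in> A \<rightarrow>\<^sub>E carrier K" for a
      using that AV by (intro lincomb_closed) auto
    show "inj_on (\<lambda>a. lincomb a A) (A \<rightarrow>\<^sub>E carrier K)"
      using rep cl by (intro inj_onI) metis
    show "(\<lambda>a. lincomb a A) ` (A \<rightarrow>\<^sub>E carrier K) = carrier V"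
      using rep cl by (fastforce simp: image_iff)
  qed
  then have "card (carrier V) = card (A \<rightarrow>\<^sub>E carrier K)"
    by (simp add: bij_betw_same_card)
  also have "\<dots> = card (carrier K) ^ card A"
    using A(1) by (simp add: card_PiE)
  finally show ?thesis
    using dim_basis[OF A] by simp
qed

lemma field_class_ring: "field (class_ring :: 'a :: field ring)"
  by (rule class_field)

lemma bit_add_self [simp]: "(x::bit) + x = 0"
  by (cases x) auto

text \<open>The only scalars are 0 and 1. Once 0 is known to send every coset to \<open>W\<close>, 1
  to fix it, and every coset to be its own negative, the module axioms become a case check.\<close>

lemma vectorspace_quotient_module:
  fixes M :: "(bit, 'b) module"
  assumes "module (class_ring :: bit ring) M" and "abelian_subgroup W M"
  shows "vectorspace (class_ring :: bit ring) (quotient_module M W)"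
proof -
  interpret M: Module.module "class_ring :: bit ring" M by fact
  interpret W: abelian_subgroup W M by fact
  let ?Q = "quotient_module M W"
  have smult0: "0 \<odot>\<^bsub>M\<^esub> x = \<zero>\<^bsub>M\<^esub>" and smult1: "1 \<odot>\<^bsub>M\<^esub> x = x" if "x \<in> carrier M" for x
    using M.smult_l_null[OF that] M.smult_one[OF that] by simp_all
  have double: "x \<oplus>\<^bsub>M\<^esub> x = \<zero>\<^bsub>M\<^esub>" if x: "x \<in> carrier M" for x
    using M.smult_l_distr[of 1 1 x] x smult0[OF x] smult1[OF x] by simp
  have group: "abelian_group ?Q"
  proof (rule comm_group_abelian_groupI)
    \<comment> \<open>The two records carry the same cosets, the same addition and the same unit,
      which is all that the group axioms mention.\<close>
    have "comm_group (add_monoid ?Q) \<longleftrightarrow> comm_group (M A_Mod W)"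
      by (simp add: quotient_module_def A_FactGroup_def FactGroup_def A_RCOSETS_def set_add_def
          comm_group_def comm_monoid_def group_def monoid_def group_axioms_def
          comm_monoid_axioms_def Units_def)
    then show "comm_group (add_monoid ?Q)"
      using W.a_factorgroup_is_comm_group by blast
  qed
  have coset: "\<exists>x\<in>carrier M. C = W +>\<^bsub>M\<^esub> x" if "C \<in> carrier ?Q" for C
    using that by (auto simp: quotient_module_def A_RCOSETS_def')
  have mem: "W +>\<^bsub>M\<^esub> x \<in> carrier ?Q" if "x \<in> carrier M" for x
    using that by (auto simp: quotient_module_def A_RCOSETS_def')
  have sub: "W +>\<^bsub>M\<^esub> x \<subseteq> carrier M" "x \<in> W +>\<^bsub>M\<^esub> x" if "x \<in> carrier M" for x
    using that W.a_rcos_self M.a_r_coset_subset_G[OF W.a_subset] by auto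
  have q0: "0 \<odot>\<^bsub>?Q\<^esub> C = W" if C: "C \<in> carrier ?Q" for C
  proof -
    obtain x where x: "x \<in> carrier M" "C = W +>\<^bsub>M\<^esub> x" using coset[OF C] by auto
    have "0 \<odot>\<^bsub>?Q\<^esub> C = (\<Union>y\<in>C. W +>\<^bsub>M\<^esub> \<zero>\<^bsub>M\<^esub>)"
      using sub(1)[OF x(1)] x(2) smult0
      by (simp add: quotient_module_def subset_iff cong: SUP_cong)
    also have "\<dots> = W"
      using sub(2)[OF x(1)] x(2) M.a_coset_add_zero[OF W.a_subset] by auto
    finally show ?thesis .
  qed
  have q1: "1 \<odot>\<^bsub>?Q\<^esub> C = C" if C: "C \<in> carrier ?Q" for C
  proof -
    obtain x where x: "x \<in> carrier M" "C = W +>\<^bsub>M\<^esub> x" using coset[OF C] by auto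
    have "W +>\<^bsub>M\<^esub> y = C" if "y \<in> C" for y
      using that x M.a_repr_independence[OF _ x(1) W.a_subgroup] by metis
    then have "1 \<odot>\<^bsub>?Q\<^esub> C = (\<Union>y\<in>C. C)"
      using sub(1)[OF x(1)] x(2) smult1
      by (simp add: quotient_module_def subset_iff cong: SUP_cong)
    also have "\<dots> = C"
      using sub(2)[OF x(1)] x(2) by auto
    finally show ?thesis .
  qed
  interpret Q: abelian_group ?Q by (rule group)
  have zero: "\<zero>\<^bsub>?Q\<^esub> = W"
    by (simp add: quotient_module_def)
  have qdouble: "C \<oplus>\<^bsub>?Q\<^esub> C = W" if C: "C \<in> carrier ?Q" for C
  proof -
    obtain x where x: "x \<in> carrier M" "C = W +>\<^bsub>M\<^esub> x" using coset[OF C] by auto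
    have "C \<oplus>\<^bsub>?Q\<^esub> C = W +>\<^bsub>M\<^esub> (x \<oplus>\<^bsub>M\<^esub> x)"
      unfolding x(2) using x(1) W.a_rcos_sum by (simp add: quotient_module_def)
    then show ?thesis
      using double[OF x(1)] M.a_coset_add_zero[OF W.a_subset] by simp
  qed
  have lr_zero: "W \<oplus>\<^bsub>?Q\<^esub> C = C" "C \<oplus>\<^bsub>?Q\<^esub> W = C" if "C \<in> carrier ?Q" for C
    using Q.l_zero[OF that] Q.r_zero[OF that] by (simp_all only: zero)
  have cases: "a = 0 \<or> a = 1" for a :: bit
    by (cases a) auto
  have W: "W \<in> carrier ?Q"
    using Q.zero_closed by (simp only: zero)
  show ?thesis
  proof (intro vectorspace.intro field_class_ring Module.module.intro group)
    show "cring (class_ring :: bit ring)"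
      by (rule Module.module.axioms(1)[OF assms(1)])
    show "module_axioms (class_ring :: bit ring) ?Q"
    proof (unfold_locales, simp_all)
      fix a b :: bit and C E assume C: "C \<in> carrier ?Q"
      show "a \<odot>\<^bsub>?Q\<^esub> C \<in> carrier ?Q"
        using cases[of a] q0[OF C] q1[OF C] C W by auto
      show "(a + b) \<odot>\<^bsub>?Q\<^esub> C = a \<odot>\<^bsub>?Q\<^esub> C \<oplus>\<^bsub>?Q\<^esub> b \<odot>\<^bsub>?Q\<^esub> C"
        using cases[of a] cases[of b] q0[OF C] q1[OF C] qdouble[OF C] C W
        by (elim disjE) (simp_all add: lr_zero)
      show "(a * b) \<odot>\<^bsub>?Q\<^esub> C = a \<odot>\<^bsub>?Q\<^esub> (b \<odot>\<^bsub>?Q\<^esub> C)"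
        using cases[of a] cases[of b] q0[OF C] q1[OF C] q0[OF W] q1[OF W] by auto
      show "1 \<odot>\<^bsub>?Q\<^esub> C = C"
        by (rule q1[OF C])
      assume E: "E \<in> carrier ?Q"
      show "a \<odot>\<^bsub>?Q\<^esub> (C \<oplus>\<^bsub>?Q\<^esub> E) = a \<odot>\<^bsub>?Q\<^esub> C \<oplus>\<^bsub>?Q\<^esub> a \<odot>\<^bsub>?Q\<^esub> E"
        using cases[of a] C E W Q.a_closed[OF C E]
        by (elim disjE) (simp_all add: q0 q1 lr_zero)
    qed
  qed
qed

section \<open>Counting in spaces of bit-valued functions\<close>

text \<open>Linear subspaces: with 0 and 1 as the only scalars, closure under scaling follows from
  these two conditions.\<close>

definition additive_set :: "('a \<Rightarrow> bit) set \<Rightarrow> bool" where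
  "additive_set V \<longleftrightarrow> (\<lambda>_. 0) \<in> V \<and> (\<forall>f\<in>V. \<forall>g\<in>V. (\<lambda>x. f x + g x) \<in> V)"

lemma additive_setD:
  assumes "additive_set V"
  shows "(\<lambda>_. 0) \<in> V" and "f \<in> V \<Longrightarrow> g \<in> V \<Longrightarrow> (\<lambda>x. f x + g x) \<in> V"
  using assms by (auto simp: additive_set_def)

text \<open>Rank and nullity in counted form: every fibre over the image is a translate of the
  kernel.\<close>

lemma card_kernel_times_image:
  fixes T :: "('a \<Rightarrow> bit) \<Rightarrow> 'b \<Rightarrow> bit"
  assumes "finite V" and V: "additive_set V"
    and T: "\<And>f g. f \<in> V \<Longrightarrow> g \<in> V \<Longrightarrow> T (\<lambda>x. f x + g x) = (\<lambda>y. T f y + T g y)"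
  shows "card V = card {f \<in> V. T f = (\<lambda>_. 0)} * card (T ` V)"
proof -
  have fibre: "card {f \<in> V. T f = h} = card {f \<in> V. T f = (\<lambda>_. 0)}" if h: "h \<in> T ` V" for h
  proof -
    obtain e where e: "e \<in> V" "h = T e" using h by auto
    \<comment> \<open>Translation by \<open>e\<close> is its own inverse because
      \<open>e x + e x = 0\<close>.\<close>
    show ?thesis
      by (rule bij_betw_same_card[of "\<lambda>f x. f x + e x"],
          rule bij_betw_byWitness[where f' = "\<lambda>f x. f x + e x"])
        (auto simp: add.assoc T e additive_setD[OF V])
  qed
  have "card V = (\<Sum>h\<in>T ` V. card {f \<in> V. T f = h})"
    using sum.image_gen[OF assms(1), of "\<lambda>_. 1" T] by (simp only: card_eq_sum)
  also have "\<dots> = (\<Sum>h\<in>T ` V. card {f \<in> V. T f = (\<lambda>_. 0)})"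
    by (intro sum.cong refl fibre)
  finally show ?thesis
    by simp
qed

definition supported :: "'a set \<Rightarrow> ('a \<Rightarrow> bit) set" where
  "supported S = {g. \<forall>s. g s \<noteq> 0 \<longrightarrow> s \<in> S}"

lemma supported_bij: "bij_betw (\<lambda>g. {s. g s \<noteq> 0}) (supported S) (Pow S)"
  by (rule bij_betw_byWitness[where f' = "\<lambda>A s. of_bool (s \<in> A)"])
    (auto simp: supported_def fun_eq_iff)

lemma finite_supported [simp]: "finite S \<Longrightarrow> finite (supported S)"
  using bij_betw_finite[OF supported_bij] by auto

lemma card_supported: "finite S \<Longrightarrow> card (supported S) = 2 ^ card S"
  using bij_betw_same_card[OF supported_bij, of S] by (simp add: card_Pow)

text \<open>Adding the indicator of \<open>s\<close> clears a nonzero value at \<open>s\<close>, so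
  the support can be emptied point by point. Surjectivity onto \<open>supported S\<close> thereby
  reduces to hitting point indicators.\<close>

lemma supported_subset_additive_set:
  assumes V: "additive_set V" and "finite S"
    and delta: "\<And>s. s \<in> S \<Longrightarrow> (\<lambda>x. of_bool (x = s)) \<in> V"
  shows "supported S \<subseteq> V"
  using \<open>finite S\<close> delta
proof (induction S)
  case empty
  have "g \<in> supported {} \<Longrightarrow> g = (\<lambda>_. 0)" for g :: "'a \<Rightarrow> bit"
    by (auto simp: supported_def)
  then show ?case
    using additive_setD(1)[OF V] by auto
next
  case (insert s S)
  show ?case
  proof
    fix g assume g: "g \<in> supported (insert s S)"
    show "g \<in> V"
    proof (cases "g s = 0")
      case True
      then have "g \<in> supported S"
        using g unfolding supported_def by blast
      then show ?thesis
        using insert by auto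
    next
      case False
      let ?h = "\<lambda>x. g x + of_bool (x = s)"
      have "?h \<in> supported S"
        using g False by (auto simp: supported_def)
      then have "?h \<in> V" "(\<lambda>x. of_bool (x = s)) \<in> V"
        using insert by auto
      then have "(\<lambda>x. ?h x + of_bool (x = s)) \<in> V"
        by (rule additive_setD(2)[OF V])
      then show ?thesis
        by (simp add: add.assoc)
    qed
  qed
qed

lemma card_odds_below: "card {s::nat. odd s \<and> s < n} = n div 2"
proof -
  have "{s::nat. odd s \<and> s < n} = (\<lambda>i. 2 * i + 1) ` {..<n div 2}"
    by (auto simp: image_iff elim!: oddE)
  then show ?thesis
    by (simp add: card_image inj_on_def)
qed

lemma bit_add_eq_0_iff: "x + y = 0 \<longleftrightarrow> x = (y::bit)"
  by (cases x; cases y) auto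

section \<open>The kernel of the derivation in degrees 2 and 3\<close>

text \<open>The kernel of \<open>D\<close> on the exterior square, respectively cube, of the space with
  basis \<open>v\<^sub>0, \<dots>, v\<^bsub>N-1\<^esub>\<close>, where \<open>v\<^sub>i = e\<^bsup>i+2\<^esup>\<close>, in terms of coefficient functions.\<close>

definition closed2 :: "nat \<Rightarrow> (nat \<times> nat \<Rightarrow> bit) set" where
  "closed2 N = {c. (\<forall>i j. c (i, j) = c (j, i)) \<and> (\<forall>i. c (i, i) = 0) \<and>
     (\<forall>i j. i \<ge> N \<longrightarrow> c (i, j) = 0) \<and> (\<forall>i j. c (Suc i, j) + c (i, Suc j) = 0)}"

definition closed3 :: "nat \<Rightarrow> (nat \<times> nat \<times> nat \<Rightarrow> bit) set" where
  "closed3 N = {c. (\<forall>i j k. c (i, j, k) = c (j, i, k) \<and> c (i, j, k) = c (i, k, j)) \<and>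
     (\<forall>i k. c (i, i, k) = 0) \<and> (\<forall>i j k. i \<ge> N \<longrightarrow> c (i, j, k) = 0) \<and>
     (\<forall>i j k. c (Suc i, j, k) + c (i, Suc j, k) + c (i, j, Suc k) = 0)}"

text \<open>In characteristic 2 the relation says that moving one unit between the two indices keeps
  the coefficient, so only \<open>i + j\<close> matters.\<close>

lemma closed2_antidiagonal:
  assumes "\<And>i j. c (Suc i, j) + c (i, Suc j) = (0::bit)"
  shows "c (i, j) = c (0, i + j)"
proof (induction i arbitrary: j)
  case (Suc i)
  have "c (Suc i, j) = c (i, Suc j)"
    using assms[of i j] by (simp add: bit_add_eq_0_iff)
  then show ?case
    using Suc[of "Suc j"] by simp
qed simp

text \<open>For even \<open>s\<close> the antidiagonal meets the diagonal at \<open>s div 2\<close>,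
  where \<open>c\<close> vanishes.\<close>

lemma antidiagonal_supported:
  assumes "\<And>i j. c (Suc i, j) + c (i, Suc j) = (0::bit)"
    and "\<And>i. c (i, i) = 0" and "\<And>j. j \<ge> N \<Longrightarrow> c (0, j) = 0"
  shows "(\<lambda>s. c (0, s)) \<in> supported {s. odd s \<and> s < N}"
proof -
  have "c (0, s) = 0" if "even s" for s
    using that closed2_antidiagonal[of c "s div 2" "s div 2", OF assms(1)] assms(2)[of "s div 2"]
    by (auto simp flip: mult_2)
  then show ?thesis
    using assms(3) unfolding supported_def by (auto simp: not_le[symmetric])
qed

lemma card_closed2: "card (closed2 N) = 2 ^ (N div 2)"
proof -
  have "bij_betw (\<lambda>c s. c (0, s)) (closed2 N) (supported {s. odd s \<and> s < N})"
  proof (rule bij_betw_byWitness[where f' = "\<lambda>g (i, j). g (i + j)"])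
    show "\<forall>c\<in>closed2 N. (\<lambda>(i, j). c (0, i + j)) = c"
    proof
      fix c assume "c \<in> closed2 N"
      then have "c (i, j) = c (0, i + j)" for i j
        by (intro closed2_antidiagonal) (auto simp: closed2_def)
      then show "(\<lambda>(i, j). c (0, i + j)) = c"
        by (auto simp: fun_eq_iff)
    qed
    show "(\<lambda>c s. c (0, s)) ` closed2 N \<subseteq> supported {s. odd s \<and> s < N}"
    proof (intro image_subsetI)
      fix c assume c: "c \<in> closed2 N"
      then show "(\<lambda>s. c (0, s)) \<in> supported {s. odd s \<and> s < N}"
        unfolding closed2_def by (intro antidiagonal_supported) (blast | metis (mono_tags, lifting) mem_Collect_eq)+
    qed
    \<comment> \<open>A function of \<open>i + j\<close> supported on odd sums below
      \<open>N\<close> vanishes on the diagonal by parity and for \<open>i \<ge> N\<close> by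
      size.\<close>
    show "(\<lambda>g (i, j). g (i + j)) ` supported {s. odd s \<and> s < N} \<subseteq> closed2 N"
      by (fastforce simp: closed2_def supported_def add.commute)
  qed auto
  then show ?thesis
    by (simp add: bij_betw_same_card card_supported card_odds_below)
qed

lemma closed3D:
  assumes "c \<in> closed3 N"
  shows "c (i, j, k) = c (j, i, k)" and "c (i, j, k) = c (i, k, j)" and "c (i, i, k) = 0"
    and "i \<ge> N \<Longrightarrow> c (i, j, k) = 0"
    and "c (Suc i, j, k) + c (i, Suc j, k) + c (i, j, Suc k) = 0"
  using assms unfolding closed3_def by blast+

lemma closed3I:
  assumes "\<And>i j k. c (i, j, k) = c (j, i, k)" and "\<And>i j k. c (i, j, k) = c (i, k, j)"
    and "\<And>i k. c (i, i, k) = 0" and "\<And>i j k. i \<ge> N \<Longrightarrow> c (i, j, k) = 0"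
    and "\<And>i j k. c (Suc i, j, k) + c (i, Suc j, k) + c (i, j, Suc k) = 0"
  shows "c \<in> closed3 N"
  using assms unfolding closed3_def by blast

lemma closed3_rec:
  "c \<in> closed3 N \<Longrightarrow> c (i, j, Suc k) = c (Suc i, j, k) + c (i, Suc j, k)"
  using closed3D(5)[of c N i j k] by (simp add: bit_add_eq_0_iff)

lemma closed3_swap:
  assumes "c \<in> closed3 N"
  shows "c (i, j, k) = c (j, i, k)" and "c (i, j, k) = c (i, k, j)"
    and "c (i, j, k) = c (k, j, i)"
  using closed3D(1,2)[OF assms] by metis+

lemma closed3_diag:
  assumes "c \<in> closed3 N"
  shows "c (i, i, k) = 0" and "c (i, k, k) = 0" and "c (i, k, i) = 0"
  using closed3D(1-3)[OF assms] by metis+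

lemma closed3_out:
  assumes "c \<in> closed3 N"
  shows "i \<ge> N \<Longrightarrow> c (i, j, k) = 0" and "j \<ge> N \<Longrightarrow> c (i, j, k) = 0"
    and "k \<ge> N \<Longrightarrow> c (i, j, k) = 0"
  using closed3D(1,2,4)[OF assms] by metis+

lemma additive_closed3: "additive_set (closed3 N)"
  unfolding additive_set_def
proof (intro conjI ballI closed3I)
  have *: "a + b + c = 0 \<Longrightarrow> a' + b' + c' = 0 \<Longrightarrow> a + a' + (b + b') + (c + c') = 0"
    for a b c a' b' c' :: bit
    by (cases a; cases b; cases c; cases a'; cases b'; cases c') auto
  fix c c' i j k assume c: "c \<in> closed3 N" and c': "c' \<in> closed3 N"
  show "c (i, j, k) + c' (i, j, k) = c (j, i, k) + c' (j, i, k)"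
    and "c (i, j, k) + c' (i, j, k) = c (i, k, j) + c' (i, k, j)"
    and "c (i, i, k) + c' (i, i, k) = 0"
    and "i \<ge> N \<Longrightarrow> c (i, j, k) + c' (i, j, k) = 0"
    using closed3D(1-4)[OF c] closed3D(1-4)[OF c'] by simp_all
  show "c (Suc i, j, k) + c' (Suc i, j, k) + (c (i, Suc j, k) + c' (i, Suc j, k)) +
      (c (i, j, Suc k) + c' (i, j, Suc k)) = 0"
    by (intro * closed3D(5)[OF c] closed3D(5)[OF c'])
qed auto

lemma finite_closed3: "finite (closed3 N)"
proof (rule finite_subset)
  show "closed3 N \<subseteq> supported ({..<N} \<times> {..<N} \<times> {..<N})"
  proof
    fix c assume c: "c \<in> closed3 N"
    show "c \<in> supported ({..<N} \<times> {..<N} \<times> {..<N})"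
      using closed3_out[OF c] by (auto simp: supported_def not_le[symmetric])
  qed
qed simp

section \<open>Power-of-two shifts and a coefficient that always vanishes\<close>

text \<open>On a closed form the shift in the third index is the sum of the commuting shifts in the
  first two. Raising to the power 2^p is additive in characteristic 2: applying the rule twice makes
  the mixed terms cancel.\<close>

lemma closed3_frobenius:
  assumes "c \<in> closed3 N"
  shows "c (i, j, k + 2 ^ p) = c (i + 2 ^ p, j, k) + c (i, j + 2 ^ p, k)"
proof (induction p arbitrary: i j k)
  case 0
  then show ?case
    using closed3_rec[OF assms] by simp
next
  case (Suc p)
  have "c (i, j, k + 2 ^ p + 2 ^ p) =
      c (i + 2 ^ p + 2 ^ p, j, k) + c (i + 2 ^ p, j + 2 ^ p, k) +
      (c (i + 2 ^ p, j + 2 ^ p, k) + c (i, j + 2 ^ p + 2 ^ p, k))"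
    by (simp only: Suc)
  also have "\<dots> = c (i + 2 ^ p + 2 ^ p, j, k) + c (i, j + 2 ^ p + 2 ^ p, k)"
    by (simp add: add.assoc)
  finally show ?case
    by (simp add: add.assoc mult_2)
qed

lemma sum_lessThan_add:
  fixes f :: "nat \<Rightarrow> 'a::comm_monoid_add"
  shows "(\<Sum>l<a + b. f l) = (\<Sum>l<a. f l) + (\<Sum>l<b. f (a + l))"
  by (induction b) (simp_all add: add.assoc)

text \<open>All binomial coefficients of \<open>2\<^sup>p - 1\<close> are odd.\<close>

lemma closed3_geometric:
  assumes "c \<in> closed3 N"
  shows "c (i, j, k + (2 ^ p - 1)) = (\<Sum>l<2 ^ p. c (i + l, j + (2 ^ p - 1 - l), k))"
proof (induction p arbitrary: i j k)
  case (Suc p)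
  let ?q = "2 ^ p :: nat"
  \<comment> \<open>With the exponent split as (q - 1) + q, the Frobenius rule treats q and the
    induction hypothesis q - 1. The two resulting sums are the upper and the lower half of the range
    of \<open>l\<close>.\<close>
  have "k + (2 ^ Suc p - 1) = k + (?q - 1) + ?q"
    using one_le_power[of "2::nat" p] by simp
  then have "c (i, j, k + (2 ^ Suc p - 1)) =
      c (i + ?q, j, k + (?q - 1)) + c (i, j + ?q, k + (?q - 1))"
    by (simp only: closed3_frobenius[OF assms])
  also have "\<dots> = (\<Sum>l<?q. c (i + ?q + l, j + (?q - 1 - l), k)) +
      (\<Sum>l<?q. c (i + l, j + ?q + (?q - 1 - l), k))"
    by (simp only: Suc)
  also have "(\<Sum>l<?q. c (i + ?q + l, j + (?q - 1 - l), k)) =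
      (\<Sum>l<?q. c (i + (?q + l), j + (?q + ?q - 1 - (?q + l)), k))"
    by (intro sum.cong refl arg_cong[of _ _ c]) auto
  also have "(\<Sum>l<?q. c (i + l, j + ?q + (?q - 1 - l), k)) =
      (\<Sum>l<?q. c (i + l, j + (?q + ?q - 1 - l), k))"
    by (intro sum.cong refl arg_cong[of _ _ c]) auto
  also have "(\<Sum>l<?q. c (i + (?q + l), j + (?q + ?q - 1 - (?q + l)), k)) +
      (\<Sum>l<?q. c (i + l, j + (?q + ?q - 1 - l), k)) =
      (\<Sum>l<?q. c (i + l, j + (?q + ?q - 1 - l), k)) +
      (\<Sum>l<?q. c (i + (?q + l), j + (?q + ?q - 1 - (?q + l)), k))"
    by (rule add.commute)
  finally show ?case
    by (simp only: power_Suc mult_2 sum_lessThan_add)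
qed simp

text \<open>The terms at \<open>l\<close> and \<open>n - 1 - l\<close> are equal and cancel, and a
  middle term lies on the diagonal. The induction peels off both ends at once.\<close>

lemma sum_antidiagonal_symmetric:
  fixes h :: "nat \<Rightarrow> nat \<Rightarrow> bit"
  assumes "\<And>a b. h a b = h b a" and "\<And>a. h a a = 0"
  shows "(\<Sum>l<n. h (x + l) (x + (n - 1 - l))) = 0"
proof (induction n arbitrary: x rule: induct_nat_012)
  case (ge2 n)
  have "(\<Sum>l<Suc (Suc n). h (x + l) (x + (Suc (Suc n) - 1 - l))) =
      h x (x + Suc n) + (\<Sum>l<n. h (x + Suc l) (x + (Suc n - Suc l))) + h (x + Suc n) x"
    by (subst sum.lessThan_Suc, subst sum.lessThan_Suc_shift) simp
  also have "(\<Sum>l<n. h (x + Suc l) (x + (Suc n - Suc l))) =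
      (\<Sum>l<n. h (Suc x + l) (Suc x + (n - 1 - l)))"
    by (intro sum.cong refl arg_cong2[of _ _ _ _ h]) auto
  also have "\<dots> = 0"
    by (rule ge2)
  finally show ?case
    using assms(1)[of "x + Suc n" x] by simp
qed (use assms in auto)

text \<open>Moving 2^p - 1 units from the third index to the others gives an antidiagonal sum with
  third index \<open>m\<close>. Its last term repeats \<open>m\<close>; without it both indices
  range symmetrically from \<open>Suc m\<close> on, so the rest cancels in pairs.\<close>

lemma closed3_vanishing:
  assumes "c \<in> closed3 N"
  shows "c (Suc m, m, m + (2 ^ p - 1)) = 0"
proof -
  obtain r where r: "(2::nat) ^ p = Suc r"
    using not0_implies_Suc[of "2 ^ p"] by auto
  have "c (Suc m, m, m + (2 ^ p - 1)) = (\<Sum>l<Suc r. c (Suc m + l, m + (r - l), m))"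
    using closed3_geometric[OF assms, of "Suc m" m m p] by (simp only: r diff_Suc_1)
  also have "\<dots> = (\<Sum>l<r. c (Suc m + l, m + (r - l), m))"
    by (simp add: closed3_diag[OF assms])
  also have "\<dots> = (\<Sum>l<r. c (Suc m + l, Suc m + (r - 1 - l), m))"
    by (intro sum.cong refl arg_cong[of _ _ c]) auto
  also have "\<dots> = 0"
    by (rule sum_antidiagonal_symmetric[of "\<lambda>a b. c (a, b, m)" "Suc m" r])
      (rule closed3_swap(1)[OF assms] closed3_diag(1)[OF assms])+
  finally show ?thesis .
qed

section \<open>The contraction operator and the leading coefficients\<close>

definition contract :: "(nat \<times> nat \<times> nat \<Rightarrow> bit) \<Rightarrow> nat \<times> nat \<times> nat \<Rightarrow> bit" where
  "contract c = (\<lambda>(i, j, k). c (Suc i, Suc j, k) + c (Suc i, j, Suc k) + c (i, Suc j, Suc k))"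

text \<open>The second elementary symmetric function in the three copies of \<open>D\<close> acting on the factors
  commutes with their sum.\<close>

lemma contract_closed3:
  assumes c: "c \<in> closed3 N"
  shows "contract c \<in> closed3 N"
proof (rule closed3I)
  fix i j k
  show "contract c (i, j, k) = contract c (j, i, k)"
    using closed3_swap(1)[OF c, of "Suc i" "Suc j" k] closed3_swap(1)[OF c, of "Suc i" j "Suc k"]
      closed3_swap(1)[OF c, of i "Suc j" "Suc k"]
    by (simp add: contract_def ac_simps)
  show "contract c (i, j, k) = contract c (i, k, j)"
    using closed3_swap(2)[OF c, of "Suc i" "Suc j" k] closed3_swap(2)[OF c, of "Suc i" j "Suc k"]
      closed3_swap(2)[OF c, of i "Suc j" "Suc k"]
    by (simp add: contract_def ac_simps)
  show "contract c (i, i, k) = 0"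
    using closed3_swap(1)[OF c, of "Suc i" i "Suc k"]
    by (simp add: contract_def closed3_diag[OF c])
  show "contract c (i, j, k) = 0" if "i \<ge> N"
    using that by (simp add: contract_def closed3_out[OF c])
  \<comment> \<open>The nine terms regroup into the closedness relations at
    \<open>(Suc i, Suc j, k)\<close>, \<open>(Suc i, j, Suc k)\<close> and
    \<open>(i, Suc j, Suc k)\<close>; the value \<open>z\<close> at
    \<open>(Suc i, Suc j, Suc k)\<close> occurs in all three.\<close>
  have six: "p + q + z = 0 \<Longrightarrow> r + s + z = 0 \<Longrightarrow> t + u + z = 0 \<Longrightarrow>
      (p + r + z) + (q + z + t) + (z + s + u) = 0" for p q r s t u z :: bit
    by (cases p; cases q; cases r; cases s; cases t; cases u; cases z) auto
  show "contract c (Suc i, j, k) + contract c (i, Suc j, k) + contract c (i, j, Suc k) = 0"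
    unfolding contract_def prod.case
  proof (rule six)
    show "c (Suc (Suc i), Suc j, k) + c (Suc i, Suc (Suc j), k) + c (Suc i, Suc j, Suc k) = 0"
      by (rule closed3D(5)[OF c])
    show "c (Suc (Suc i), j, Suc k) + c (Suc i, j, Suc (Suc k)) + c (Suc i, Suc j, Suc k) = 0"
      using closed3D(5)[OF c, of "Suc i" j "Suc k"] by (simp add: ac_simps)
    show "c (i, Suc (Suc j), Suc k) + c (i, Suc j, Suc (Suc k)) + c (Suc i, Suc j, Suc k) = 0"
      using closed3D(5)[OF c, of i "Suc j" "Suc k"] by (simp add: ac_simps)
  qed
qed

lemma contract_power_closed3: "c \<in> closed3 N \<Longrightarrow> (contract ^^ r) c \<in> closed3 N"
  by (induction r) (auto intro: contract_closed3)

text \<open>Since coefficients with an index \<open>Suc N\<close> are zero, the relation at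
  \<open>(N, i, j)\<close> loses its first term. The leading part is therefore a closed 2-form,
  constant along antidiagonals.\<close>

lemma closed3_top:
  assumes "c \<in> closed3 (Suc N)"
  shows "c (N, i, j) = c (N, 0, i + j)"
  using closed2_antidiagonal[of "\<lambda>(i, j). c (N, i, j)" i j] closed3D(5)[OF assms, of N]
    closed3_out(1)[OF assms, of "Suc N"] by simp

text \<open>Only the summand that leaves the index \<open>N\<close> unshifted survives. A leading
  form concentrated in the sum \<open>s + 2\<close> is thus moved to the sum
  \<open>s\<close>.\<close>

lemma contract_top:
  assumes "c \<in> closed3 (Suc N)"
  shows "contract c (N, 0, s) = c (N, 0, s + 2)"
  using closed3_top[OF assms, of "Suc 0" "Suc s"] closed3_out(1)[OF assms, of "Suc N"]
  by (simp add: contract_def)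

lemma contract_power_top:
  assumes "c \<in> closed3 (Suc N)"
  shows "(contract ^^ r) c (N, 0, s) = c (N, 0, s + 2 * r)"
proof (induction r arbitrary: s)
  case (Suc r)
  show ?case
    using contract_top[OF contract_power_closed3[OF assms], of r s] Suc[of "s + 2"] by simp
qed simp

text \<open>Even sums hit the diagonal. An odd \<open>s \<ge> 2 * m\<close> is
  \<open>2 * m + 1 + 2 * r\<close>, so \<open>r\<close> contractions turn its coefficient into the
  one at \<open>(N, Suc m, m)\<close>. As \<open>N = m + (2 ^ p - 1)\<close>,
  \<open>closed3_vanishing\<close> applies.\<close>

lemma closed3_top_supported:
  assumes c: "c \<in> closed3 (Suc N)" and N: "Suc N = 2 ^ p + m"
  shows "(\<lambda>s. c (N, 0, s)) \<in> supported {s. odd s \<and> s < 2 * m}"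
proof (rule antidiagonal_supported[of "\<lambda>(i, j). c (N, i, j)" "2 * m", simplified])
  show odd: "c (N, Suc i, j) + c (N, i, Suc j) = 0" for i j
    using closed3D(5)[OF c, of N i j] closed3_out(1)[OF c, of "Suc N"] by simp
  show diag: "c (N, i, i) = 0" for i
    by (rule closed3_diag(2)[OF c])
  show "c (N, 0, s) = 0" if s: "2 * m \<le> s" for s
  proof (cases "even s")
    case True
    then show ?thesis
      using closed3_top[OF c, of "s div 2" "s div 2"] diag[of "s div 2"] by (auto simp flip: mult_2)
  next
    case False
    then obtain q where "s = 2 * q + 1"
      by (rule oddE)
    then obtain r where r: "s = Suc m + m + 2 * r"
      using s that[of "q - m"] by simp
    let ?c = "(contract ^^ r) c"
    have arith_N: "N = m + (2 ^ p - 1)"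
      using N one_le_power[of "2::nat" p] by simp
    have "c (N, 0, s) = ?c (N, Suc m, m)"
      using contract_power_top[OF c, of r "Suc m + m"]
        closed3_top[OF contract_power_closed3[OF c], of r "Suc m" m]
      by (simp only: r)
    also have "\<dots> = ?c (Suc m, m, N)"
      using closed3_swap[OF contract_power_closed3[OF c]] by metis
    also have "\<dots> = 0"
      using closed3_vanishing[OF contract_power_closed3[OF c], of r m p]
      by (simp add: arith_N)
    finally show ?thesis .
  qed
qed

section \<open>Multinomial coefficients modulo 2\<close>

text \<open>Equivalent to the multinomial coefficient \<open>(2\<^sup>t - 1)! / (a! b! c!)\<close> being defined and odd.\<close>

fun digit_partition :: "nat \<Rightarrow> nat \<Rightarrow> nat \<Rightarrow> nat \<Rightarrow> bool" where
  "digit_partition 0 a b c \<longleftrightarrow> a = 0 \<and> b = 0 \<and> c = 0"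
| "digit_partition (Suc t) a b c \<longleftrightarrow>
     of_bool (odd a) + of_bool (odd b) + of_bool (odd c) = (1::nat) \<and>
     digit_partition t (a div 2) (b div 2) (c div 2)"

lemma digit_partition_swap12: "digit_partition t a b c = digit_partition t b a c"
proof (induction t arbitrary: a b c)
  case (Suc t)
  show ?case
    using Suc[of "a div 2" "b div 2" "c div 2"] by (simp add: ac_simps)
qed auto

lemma digit_partition_swap23: "digit_partition t a b c = digit_partition t a c b"
proof (induction t arbitrary: a b c)
  case (Suc t)
  show ?case
    using Suc[of "a div 2" "b div 2" "c div 2"] by (simp add: ac_simps)
qed auto

lemma digit_partition_sum: "digit_partition t a b c \<Longrightarrow> Suc (a + b + c) = 2 ^ t"
proof (induction t arbitrary: a b c)
  case (Suc t)
  have "a = 2 * (a div 2) + of_bool (odd a)" "b = 2 * (b div 2) + of_bool (odd b)"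
    "c = 2 * (c div 2) + of_bool (odd c)"
    by auto
  moreover have "Suc (a div 2 + b div 2 + c div 2) = 2 ^ t"
    using Suc by simp
  moreover have "of_bool (odd a) + of_bool (odd b) + of_bool (odd c) = (1::nat)"
    using Suc.prems by simp
  ultimately show ?case
    unfolding power_Suc by linarith
qed simp

text \<open>A binary digit 1 of the repeated argument would be counted twice in its place.\<close>

lemma digit_partition_diag: "digit_partition t a a c \<Longrightarrow> a = 0"
proof (induction t arbitrary: a c)
  case (Suc t)
  then have "even a"
    by (cases "even a") auto
  moreover have "a div 2 = 0"
    using Suc by simp blast
  ultimately show ?case
    by auto
qed simp

text \<open>The complement of \<open>b\<close> among \<open>t\<close> binary digits is 2^t - 1 - b,
  so with one argument 0 the sum alone decides.\<close>

lemma digit_partition_zero: "digit_partition t 0 b c \<longleftrightarrow> Suc (b + c) = 2 ^ t"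
proof (induction t arbitrary: b c)
  case (Suc t)
  show ?case
  proof
    assume "Suc (b + c) = 2 ^ Suc t"
    then have *: "odd (b + c)" "Suc (b + c) = 2 * 2 ^ t"
      by (auto dest: arg_cong[of _ _ even])
    then have "Suc (b div 2 + c div 2) = 2 ^ t"
      by (cases "even b") (auto elim!: evenE oddE)
    with Suc * show "digit_partition (Suc t) 0 b c"
      by auto
  qed (use digit_partition_sum in fastforce)
qed auto

text \<open>The multinomial coefficients of \<open>2\<^sup>t\<close> are even, except for the three trivial ones.\<close>

lemma digit_partition_pascal:
  assumes "a < 2 ^ t" "b < 2 ^ t" "c < 2 ^ t"
  shows "of_bool (a > 0 \<and> digit_partition t (a - 1) b c) +
    of_bool (b > 0 \<and> digit_partition t a (b - 1) c) +
    of_bool (c > 0 \<and> digit_partition t a b (c - 1)) = (0::bit)"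
  using assms
proof (induction t arbitrary: a b c)
  case (Suc t)
  \<comment> \<open>Decrementing a positive even number makes its last digit 1 and lowers its half
    by one, so the other two numbers must be even.\<close>
  have pred: "0 < 2 * x \<and> digit_partition (Suc t) (2 * x - 1) y z \<longleftrightarrow>
      even y \<and> even z \<and> 0 < x \<and> digit_partition t (x - 1) (y div 2) (z div 2)"
    "0 < 2 * x \<and> digit_partition (Suc t) y (2 * x - 1) z \<longleftrightarrow>
      even y \<and> even z \<and> 0 < x \<and> digit_partition t (y div 2) (x - 1) (z div 2)"
    "0 < 2 * x \<and> digit_partition (Suc t) y z (2 * x - 1) \<longleftrightarrow>
      even y \<and> even z \<and> 0 < x \<and> digit_partition t (y div 2) (z div 2) (x - 1)"
    for x y z :: nat
    by (cases x; auto)+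
  have parity: "\<exists>y. x = 2 * y \<or> x = Suc (2 * y)" for x :: nat
    by (cases "even x") (auto elim!: evenE oddE)
  obtain a' b' c' where abc: "a = 2 * a' \<or> a = Suc (2 * a')" "b = 2 * b' \<or> b = Suc (2 * b')"
    "c = 2 * c' \<or> c = Suc (2 * c')"
    using parity by meson
  then have half: "a' < 2 ^ t" "b' < 2 ^ t" "c' < 2 ^ t"
    using Suc.prems by auto
  \<comment> \<open>If all three are even, this is the induction hypothesis. If exactly two are odd,
    decrementing either of them leaves the same triple of halves and the two terms cancel. Otherwise
    no term has exactly one odd entry.\<close>
  from abc show ?case
    using Suc.IH[OF half]
    by (elim disjE) (simp_all only: pred, simp_all)
qed auto

text \<open>In the exponents \<open>N - i\<close>, \<open>N - j\<close>, \<open>N - k\<close>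
  raising an index lowers an exponent, so closedness is the Pascal relation. On the diagonal the
  repeated exponent is 0 and the third is 2^t - 1, which exceeds \<open>N\<close>.\<close>

lemma digit_partition_closed3:
  assumes "Suc N < 2 ^ t"
  shows "(\<lambda>(i, j, k). of_bool (i \<le> N \<and> j \<le> N \<and> k \<le> N \<and>
    digit_partition t (N - i) (N - j) (N - k))) \<in> closed3 (Suc N)" (is "?c \<in> _")
proof (rule closed3I)
  fix i j k
  show "?c (i, j, k) = ?c (j, i, k)" "?c (i, j, k) = ?c (i, k, j)"
    using digit_partition_swap12 digit_partition_swap23 by auto
  show "?c (i, i, k) = 0"
  proof (rule ccontr)
    assume "?c (i, i, k) \<noteq> 0"
    then have d: "digit_partition t (N - i) (N - i) (N - k)"
      by (auto split: if_splits)
    then have "Suc (N - k) = 2 ^ t"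
      using digit_partition_diag[OF d] digit_partition_sum[OF d] by simp
    then show False
      using assms by simp
  qed
  show "?c (i, j, k) = 0" if "i \<ge> Suc N"
    using that by simp
  show "?c (Suc i, j, k) + ?c (i, Suc j, k) + ?c (i, j, Suc k) = 0"
  proof (cases "i \<le> N \<and> j \<le> N \<and> k \<le> N")
    case True
    have "N - i < 2 ^ t" "N - j < 2 ^ t" "N - k < 2 ^ t"
      using assms by auto
    from digit_partition_pascal[OF this] show ?thesis
      using True by (simp add: Suc_le_eq)
  qed auto
qed

section \<open>Growth of the kernel in degree 3\<close>

lemma closed3_top_image:
  assumes N: "Suc N = 2 ^ p + m" and m: "m < 2 ^ p"
  shows "(\<lambda>c s. c (N, 0, s)) ` closed3 (Suc N) = supported {s. odd s \<and> s < 2 * m}"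
proof
  let ?V = "(\<lambda>c s. c (N, 0, s)) ` closed3 (Suc N)"
  show "?V \<subseteq> supported {s. odd s \<and> s < 2 * m}"
    using closed3_top_supported[OF _ N] by auto
  \<comment> \<open>At \<open>(N, 0, x)\<close> the exponents are 0, N and N - x. Their sum is
    2^(p+1) - 1 exactly for x = 2m - 1, so for positive \<open>m\<close> this is the only leading
    coefficient.\<close>
  let ?c = "\<lambda>(i, j, k). of_bool (i \<le> N \<and> j \<le> N \<and> k \<le> N \<and>
    digit_partition (Suc p) (N - i) (N - j) (N - k)) :: bit"
  have c: "?c \<in> closed3 (Suc N)"
    using N m by (intro digit_partition_closed3) simp
  show "supported {s. odd s \<and> s < 2 * m} \<subseteq> ?V"
  proof (rule supported_subset_additive_set)
    show "additive_set ?V"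
      unfolding additive_set_def
    proof (intro conjI ballI)
      show "(\<lambda>_. 0) \<in> ?V"
        using additive_setD(1)[OF additive_closed3] by (rule rev_image_eqI) simp
      fix f g assume "f \<in> ?V" "g \<in> ?V"
      then obtain c e where "c \<in> closed3 (Suc N)" "e \<in> closed3 (Suc N)"
        "f = (\<lambda>s. c (N, 0, s))" "g = (\<lambda>s. e (N, 0, s))"
        by auto
      then show "(\<lambda>x. f x + g x) \<in> ?V"
        using additive_setD(2)[OF additive_closed3, of c "Suc N" e]
        by (intro image_eqI[of _ _ "\<lambda>x. c x + e x"]) auto
    qed
    fix s assume s: "s \<in> {s. odd s \<and> s < 2 * m}"
    then obtain q where "s = 2 * q + 1" "s < 2 * m"
      by (auto elim: oddE)
    \<comment> \<open>The number of contractions that bring the leading sum from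
      \<open>2 * m - 1\<close> down to \<open>s\<close>.\<close>
    then obtain r where r: "s + 2 * r = 2 * m - 1"
      using that[of "m - 1 - q"] by simp
    have "(contract ^^ r) ?c (N, 0, x) = of_bool (x = s)" for x
    proof -
      have "(contract ^^ r) ?c (N, 0, x) = ?c (N, 0, x + 2 * r)"
        by (rule contract_power_top[OF c])
      also have "\<dots> = of_bool (x + 2 * r \<le> N \<and> Suc (N + (N - (x + 2 * r))) = 2 ^ Suc p)"
        by (simp add: digit_partition_zero del: digit_partition.simps)
      also have "\<dots> = of_bool (x = s)"
        using N m r s by (intro arg_cong[of _ _ of_bool]) auto
      finally show ?thesis .
    qed
    then show "(\<lambda>x. of_bool (x = s)) \<in> ?V"
      using contract_power_closed3[OF c, of r] by (intro image_eqI[of _ _ "(contract ^^ r) ?c"]) auto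
  qed simp
qed

text \<open>By \<open>closed3_top\<close> the values at \<open>(N, 0, s)\<close> determine all
  coefficients involving \<open>N\<close>; if they vanish, the form lives on the first
  \<open>N\<close> basis vectors.\<close>

lemma closed3_Suc_kernel: "{c \<in> closed3 (Suc N). (\<lambda>s. c (N, 0, s)) = (\<lambda>_. 0)} = closed3 N"
proof (intro equalityI subsetI)
  fix c assume "c \<in> {c \<in> closed3 (Suc N). (\<lambda>s. c (N, 0, s)) = (\<lambda>_. 0)}"
  then have c: "c \<in> closed3 (Suc N)" and top: "c (N, 0, s) = 0" for s
    by (auto dest: fun_cong)
  show "c \<in> closed3 N"
  proof (rule closed3I)
    show "c (i, j, k) = 0" if "i \<ge> N" for i j k
      using that closed3_top[OF c, of j k] top closed3_out(1)[OF c, of i]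
      by (cases "i = N") auto
  qed (rule closed3D[OF c])+
next
  fix c assume c: "c \<in> closed3 N"
  have "c \<in> closed3 (Suc N)"
  proof (rule closed3I)
    show "c (i, j, k) = 0" if "i \<ge> Suc N" for i j k
      using that closed3_out(1)[OF c] by simp
  qed (rule closed3D[OF c])+
  then show "c \<in> {c \<in> closed3 (Suc N). (\<lambda>s. c (N, 0, s)) = (\<lambda>_. 0)}"
    using closed3_out(1)[OF c] by simp
qed

lemma card_closed3_Suc:
  assumes "Suc N = 2 ^ p + m" and "m < 2 ^ p"
  shows "card (closed3 (Suc N)) = card (closed3 N) * 2 ^ m"
proof -
  have "card (closed3 (Suc N)) = card {c \<in> closed3 (Suc N). (\<lambda>s. c (N, 0, s)) = (\<lambda>_. 0)} *
      card ((\<lambda>c s. c (N, 0, s)) ` closed3 (Suc N))"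
    by (rule card_kernel_times_image[OF finite_closed3 additive_closed3]) simp
  then show ?thesis
    by (simp add: closed3_Suc_kernel closed3_top_image[OF assms] card_supported card_odds_below)
qed

text \<open>Within a block starting at 2^p the successive steps add 0, 1, ..., m - 1 to the
  dimension. The factor 6 clears denominators, and integers avoid truncated subtraction.\<close>

lemma card_closed3_from_power:
  assumes "m \<le> 2 ^ p" and "card (closed3 (2 ^ p - 1)) = 2 ^ e"
    and "6 * int e = (2 ^ p - 1) * (2 ^ p - 2)"
  shows "\<exists>e. card (closed3 (2 ^ p + m - 1)) = 2 ^ e \<and>
    6 * int e = (2 ^ p - 1) * (2 ^ p - 2) + 3 * int m * (int m - 1)"
  using assms(1)
proof (induction m)
  case 0
  then show ?case
    using assms by auto
next
  case (Suc m)
  then obtain e where e: "card (closed3 (2 ^ p + m - 1)) = 2 ^ e"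
    "6 * int e = (2 ^ p - 1) * (2 ^ p - 2) + 3 * int m * (int m - 1)"
    by auto
  have N: "Suc (2 ^ p + m - 1) = 2 ^ p + m"
    by simp
  have "card (closed3 (2 ^ p + m)) = 2 ^ (e + m)"
    using card_closed3_Suc[OF N] Suc.prems e(1) by (simp add: power_add)
  then show ?case
    using e(2) by (intro exI[of _ "e + m"]) (simp add: algebra_simps)
qed

lemma closed3_0: "closed3 0 = {\<lambda>_. 0}"
proof -
  have "c = (\<lambda>_. 0)" if "c \<in> closed3 0" for c
    using closed3_out(1)[OF that] by auto
  then show ?thesis
    using additive_setD(1)[OF additive_closed3] by blast
qed

text \<open>The end m = 2^p of one block is the start of the next. With Q = 2^p the formulas match
  because (Q - 1)(Q - 2) + 3Q(Q - 1) = (2Q - 1)(2Q - 2).\<close>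

lemma card_closed3:
  "m \<le> 2 ^ p \<Longrightarrow> \<exists>e. card (closed3 (2 ^ p + m - 1)) = 2 ^ e \<and>
    6 * int e = (2 ^ p - 1) * (2 ^ p - 2) + 3 * int m * (int m - 1)"
proof (induction p arbitrary: m)
  case 0
  then show ?case
    by (intro card_closed3_from_power[of _ 0 0]) (auto simp: closed3_0)
next
  case (Suc p)
  obtain e where e: "card (closed3 (2 ^ p + 2 ^ p - 1)) = 2 ^ e"
    "6 * int e = (2 ^ p - 1) * (2 ^ p - 2) + 3 * int (2 ^ p) * (int (2 ^ p) - 1)"
    using Suc.IH[of "2 ^ p"] by auto
  show ?case
  proof (rule card_closed3_from_power[OF Suc.prems])
    show "card (closed3 (2 ^ Suc p - 1)) = 2 ^ e"
      using e(1) by (simp add: mult_2)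
    show "6 * int e = (2 ^ Suc p - 1) * (2 ^ Suc p - 2)"
      unfolding e(2) by (simp add: algebra_simps)
  qed
qed

section \<open>Reduction of the Betti numbers to the kernel of the derivation\<close>

lemma d_one_m0_generator:
  assumes "i \<in> {1..n}"
  shows "d_one n (m0_bracket n) (monomial_form {i}) =
    (if i \<le> 2 then (\<lambda>I. 0) else monomial_form {1, i - 1})"
proof
  fix K
  let ?\<alpha> = "d_one n (m0_bracket n) (monomial_form {i})"
  show "?\<alpha> K = (if i \<le> 2 then (\<lambda>I. 0) else monomial_form {1, i - 1}) K"
  proof (cases "finite K")
    case True
    \<comment> \<open>The empty monomial is a unit for the wedge product on finite index sets, so
      \<open>d_one\<close> of a generator can be read off from
      \<open>d_m0_generators\<close>.\<close>
    have "wedge ?\<alpha> (monomial_form {}) K = (\<Sum>J\<in>Pow K. if J = K then ?\<alpha> J else 0)"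
      unfolding wedge_def by (intro sum.cong refl) (auto simp: monomial_form_def)
    also have "\<dots> = ?\<alpha> K"
      using True by simp
    finally have "?\<alpha> K = d_form n (m0_bracket n) (monomial_form {i}) K"
      using d_form_monomial[of "{i}" n "m0_bracket n"] assms by simp
    also have "\<dots> = (if i \<le> 2 then (\<lambda>I. 0) else monomial_form {1, i - 1}) K"
      using assms by (auto simp: d_m0_generators wedge_monomial_form insert_commute)
    finally show ?thesis .
  next
    case False
    then have "\<not> K \<subseteq> {1..n}" "K \<noteq> {1, i - 1}"
      using finite_subset by auto
    then show ?thesis
      by (simp add: d_one_def monomial_form_def)
  qed
qed

text \<open>This is e^1 \<and> D \<omega> in coefficients: e^K arises from e^I by replacing some i
  in I by j = i - 1 and adjoining 1, so I is recovered from K by deleting 1 and raising j.\<close>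

lemma d_form_m0:
  "d_form n (m0_bracket n) \<omega> K = (if 1 \<in> K \<and> K \<subseteq> {1..n}
    then \<Sum>j | j \<in> K - {1} \<and> Suc j \<notin> K \<and> j < n. \<omega> (insert (Suc j) (K - {1, j})) else 0)"
proof -
  \<comment> \<open>The Leibniz summand of e^I at \<open>i\<close> is exactly e^K;
    \<open>1 \<notin> I\<close> and \<open>i - 1 \<notin> I\<close> keep the wedge product from
    vanishing.\<close>
  define P where "P I i \<longleftrightarrow>
    3 \<le> i \<and> 1 \<notin> I \<and> i - 1 \<notin> I \<and> K = insert 1 (insert (i - 1) (I - {i}))" for I i
  have wedge_term: "wedge (d_one n (m0_bracket n) (monomial_form {i})) (monomial_form (I - {i})) K =
      of_bool (P I i)" if "I \<subseteq> {1..n}" "i \<in> I" for I i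
  proof (cases "i \<le> 2")
    case True
    then show ?thesis
      using that d_one_m0_generator[of i n] by (auto simp: wedge_def P_def)
  next
    case False
    have fin: "finite (I - {i})"
      using that finite_subset by auto
    have iff: "{1, i - 1} \<inter> (I - {i}) = {} \<longleftrightarrow> 1 \<notin> I \<and> i - 1 \<notin> I"
      using False by auto
    have "wedge (d_one n (m0_bracket n) (monomial_form {i})) (monomial_form (I - {i})) =
        wedge (monomial_form {1, i - 1}) (monomial_form (I - {i}))"
      using False that d_one_m0_generator[of i n] by auto
    also have "\<dots> = (if 1 \<notin> I \<and> i - 1 \<notin> I then monomial_form ({1, i - 1} \<union> (I - {i})) else (\<lambda>K. 0))"
      using fin by (simp only: wedge_monomial_form finite.intros iff)
    finally show ?thesis
      using False by (simp add: P_def monomial_form_def)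
  qed
  let ?X = "SIGMA I:Pow {1..n}. I"
  have finX: "finite ?X"
    by (intro finite_SigmaI) (auto intro: finite_subset)
  have "d_form n (m0_bracket n) \<omega> K = (\<Sum>I\<in>Pow {1..n}. \<Sum>i\<in>I. if P I i then \<omega> I else 0)"
    unfolding d_form_def sum_distrib_left by (intro sum.cong refl) (auto simp: wedge_term)
  also have "\<dots> = (\<Sum>(I, i)\<in>?X. if P I i then \<omega> I else 0)"
    by (rule sum.Sigma) (auto intro: finite_subset)
  also have "\<dots> = (\<Sum>(I, i)\<in>{x \<in> ?X. case x of (I, i) \<Rightarrow> P I i}. \<omega> I)"
    by (subst sum.inter_filter[OF finX]) (auto intro!: sum.cong)
  also have "\<dots> = (if 1 \<in> K \<and> K \<subseteq> {1..n}
    then \<Sum>j | j \<in> K - {1} \<and> Suc j \<notin> K \<and> j < n. \<omega> (insert (Suc j) (K - {1, j})) else 0)"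
  proof (cases "1 \<in> K \<and> K \<subseteq> {1..n}")
    case True
    have "(\<Sum>(I, i)\<in>{x \<in> ?X. case x of (I, i) \<Rightarrow> P I i}. \<omega> I) =
      (\<Sum>j | j \<in> K - {1} \<and> Suc j \<notin> K \<and> j < n. \<omega> (insert (Suc j) (K - {1, j})))"
    proof (rule sum.reindex_bij_witness[where i = "\<lambda>j. (insert (Suc j) (K - {1, j}), Suc j)"
          and j = "\<lambda>(I, i). i - 1"], goal_cases)
      case (1 x)
      obtain I i where x: "x = (I, i)" by (cases x)
      with 1 have *: "i \<in> I" "3 \<le> i" "1 \<notin> I" "i - 1 \<notin> I" "K = insert 1 (insert (i - 1) (I - {i}))"
        by (auto simp: P_def)
      then have "insert i (K - {1, i - 1}) = I"
        by auto
      with * show ?case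
        by (simp add: x)
    next
      case (2 x)
      obtain I i where x: "x = (I, i)" by (cases x)
      with 2 have *: "I \<subseteq> {1..n}" "i \<in> I" "3 \<le> i" "1 \<notin> I" "i - 1 \<notin> I"
        "K = insert 1 (insert (i - 1) (I - {i}))"
        by (auto simp: P_def)
      then show ?case
        by (auto simp: x)
    next
      case (3 j)
      then show ?case by simp
    next
      case (4 j)
      then have "2 \<le> j"
        using True by (cases "j = 0"; cases "j = 1") auto
      with 4 True show ?case
        by (auto simp: P_def)
    next
      case (5 x)
      obtain I i where x: "x = (I, i)" by (cases x)
      with 5 have *: "i \<in> I" "3 \<le> i" "1 \<notin> I" "i - 1 \<notin> I" "K = insert 1 (insert (i - 1) (I - {i}))"
        by (auto simp: P_def)
      then have "insert i (K - {1, i - 1}) = I"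
        by auto
      with * show ?case
        by (simp add: x)
    qed
    then show ?thesis
      using True by simp
  next
    case False
    have "P I i \<Longrightarrow> I \<subseteq> {1..n} \<Longrightarrow> i \<in> I \<Longrightarrow> 1 \<in> K \<and> K \<subseteq> {1..n}" for I i
      unfolding P_def by fastforce
    then have "{x \<in> ?X. case x of (I, i) \<Rightarrow> P I i} = {}"
      using False by auto
    then show ?thesis
      by (simp only: False sum.empty if_False)
  qed
  finally show ?thesis .
qed

section \<open>Cocycles and coboundaries through the derivation\<close>

definition monomials :: "nat set \<Rightarrow> nat \<Rightarrow> nat set set" where
  "monomials A q = {I. I \<subseteq> A \<and> card I = q}"

lemma finite_monomials [simp]: "finite A \<Longrightarrow> finite (monomials A q)"
  by (simp add: monomials_def)

text \<open>The kernel of D on q-forms in e^2, ..., e^n. A summand with \<open>Suc j \<in> L\<close>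
  or \<open>j = n\<close> is 0, since its index set is too small or leaves
  \<open>{2..n}\<close>.\<close>

definition closed_forms :: "nat \<Rightarrow> nat \<Rightarrow> form set" where
  "closed_forms n q = {\<omega> \<in> supported (monomials {2..n} q).
     \<forall>L\<in>monomials {2..n} q. (\<Sum>j\<in>L. \<omega> (insert (Suc j) (L - {j}))) = 0}"

lemma carrier_form_space: "carrier (form_space n q) = supported (monomials {1..n} q)"
  by (auto simp: form_space_def supported_def monomials_def)

lemma supported_iff: "\<omega> \<in> supported S \<longleftrightarrow> (\<forall>x. x \<notin> S \<longrightarrow> \<omega> x = 0)"
  by (auto simp: supported_def)

lemma supported_0: "\<omega> \<in> supported S \<Longrightarrow> x \<notin> S \<Longrightarrow> \<omega> x = 0"
  by (simp add: supported_iff)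

lemma supported_mono: "S \<subseteq> S' \<Longrightarrow> supported S \<subseteq> supported S'"
  by (auto simp: supported_def)

lemma additive_supported: "additive_set (supported S)"
  by (auto simp: additive_set_def supported_iff)

lemma d_form_m0_add:
  "d_form n (m0_bracket n) (\<lambda>I. \<alpha> I + \<beta> I) =
    (\<lambda>K. d_form n (m0_bracket n) \<alpha> K + d_form n (m0_bracket n) \<beta> K)"
  by (rule ext) (simp add: d_form_m0 sum.distrib)

lemma d_form_m0_supported:
  assumes "\<omega> \<in> supported (monomials {1..n} q)"
  shows "d_form n (m0_bracket n) \<omega> \<in> supported {K \<in> monomials {1..n} (Suc q). 1 \<in> K}"
  unfolding supported_def
proof (rule CollectI, intro allI impI)
  fix K assume "d_form n (m0_bracket n) \<omega> K \<noteq> 0"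
  then have K: "1 \<in> K" "K \<subseteq> {1..n}"
    and S: "(\<Sum>j | j \<in> K - {1} \<and> Suc j \<notin> K \<and> j < n. \<omega> (insert (Suc j) (K - {1, j}))) \<noteq> 0"
    by (auto simp: d_form_m0 split: if_splits)
  obtain j where "j \<in> {j. j \<in> K - {1} \<and> Suc j \<notin> K \<and> j < n}"
    and \<omega>j: "\<omega> (insert (Suc j) (K - {1, j})) \<noteq> 0"
    by (rule sum.not_neutral_contains_not_neutral[OF S])
  then have j: "j \<in> K - {1}" "Suc j \<notin> K"
    by auto
  have "finite K"
    using K(2) finite_subset by auto
  then have "card (insert (Suc j) (K - {1, j})) = Suc (card K - 2)" "card K \<ge> 2"
    using j K(1) card_mono[of K "{1, j}"] by (auto simp: card_Diff_subset)
  moreover have "card (insert (Suc j) (K - {1, j})) = q"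
    using supported_0[OF assms] \<omega>j unfolding monomials_def by blast
  ultimately show "K \<in> {K \<in> monomials {1..n} (Suc q). 1 \<in> K}"
    using K by (auto simp: monomials_def)
qed

text \<open>Multiplication by e^1 kills the monomials containing e^1 and is injective on forms in
  the remaining generators, so only D of the part without e^1 counts.\<close>

lemma d_form_m0_closed_forms:
  assumes "\<omega> \<in> supported (monomials {1..n} q)"
  shows "d_form n (m0_bracket n) \<omega> = (\<lambda>_. 0) \<longleftrightarrow>
    (\<lambda>I. if 1 \<in> I then 0 else \<omega> I) \<in> closed_forms n q"
proof -
  have eq: "d_form n (m0_bracket n) \<omega> (insert 1 L) = (\<Sum>j\<in>L. \<omega> (insert (Suc j) (L - {j})))"
    if L: "L \<in> monomials {2..n} q" for L
  proof -
    have sub: "1 \<notin> L" "L \<subseteq> {2..n}" and fin: "finite L" and card: "card L = q"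
      using L finite_subset by (auto simp: monomials_def)
    have "\<omega> (insert (Suc j) (L - {j})) = 0" if j: "j \<in> L" "Suc j \<in> L \<or> \<not> j < n" for j
    proof (rule supported_0[OF assms])
      have "card (L - {j}) = q - 1" "q > 0"
        using j fin card card_gt_0_iff by auto
      then show "insert (Suc j) (L - {j}) \<notin> monomials {1..n} q"
        using j fin by (auto simp: monomials_def insert_absorb)
    qed
    then have "(\<Sum>j\<in>L. \<omega> (insert (Suc j) (L - {j}))) =
        (\<Sum>j | j \<in> L \<and> Suc j \<notin> L \<and> j < n. \<omega> (insert (Suc j) (L - {j})))"
      using fin by (intro sum.mono_neutral_right) auto
    also have "\<dots> = (\<Sum>j | j \<in> insert 1 L - {1} \<and> Suc j \<notin> insert 1 L \<and> j < n.
        \<omega> (insert (Suc j) (insert 1 L - {1, j})))"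
      using sub by (intro sum.cong arg_cong[of _ _ \<omega>]) auto
    also have "\<dots> = d_form n (m0_bracket n) \<omega> (insert 1 L)"
    proof (cases "L = {}")
      case False
      then show ?thesis
        using sub by (auto simp: d_form_m0)
    qed (auto simp: d_form_m0)
    finally show ?thesis by simp
  qed
  have eq2: "(\<Sum>j\<in>L. if 1 \<in> insert (Suc j) (L - {j}) then 0 else \<omega> (insert (Suc j) (L - {j}))) =
      (\<Sum>j\<in>L. \<omega> (insert (Suc j) (L - {j})))" if L: "L \<in> monomials {2..n} q" for L
    using L by (intro sum.cong) (auto simp: monomials_def)
  have sup: "(\<lambda>I. if 1 \<in> I then 0 else \<omega> I) \<in> supported (monomials {2..n} q)"
    unfolding supported_def
  proof (intro CollectI allI impI)
    fix I assume "(if 1 \<in> I then 0 else \<omega> I) \<noteq> 0"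
    then have "1 \<notin> I" "I \<subseteq> {1..n}" "card I = q"
      using supported_0[OF assms, of I] by (auto simp: monomials_def split: if_splits)
    moreover from this have "I \<subseteq> {2..n}"
      by (auto simp: subset_iff Suc_le_eq numeral_2_eq_2) (metis Suc_lessI)
    ultimately show "I \<in> monomials {2..n} q"
      by (simp add: monomials_def)
  qed
  have "d_form n (m0_bracket n) \<omega> = (\<lambda>_. 0) \<longleftrightarrow>
      (\<forall>L\<in>monomials {2..n} q. d_form n (m0_bracket n) \<omega> (insert 1 L) = 0)"
  proof (intro iffI ext)
    fix K assume *: "\<forall>L\<in>monomials {2..n} q. d_form n (m0_bracket n) \<omega> (insert 1 L) = 0"
    show "d_form n (m0_bracket n) \<omega> K = 0"
    proof (rule ccontr)
      assume "d_form n (m0_bracket n) \<omega> K \<noteq> 0"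
      then have K: "K \<subseteq> {1..n}" "card K = Suc q" "1 \<in> K"
        using supported_0[OF d_form_m0_supported[OF assms]] unfolding monomials_def by blast+
      then have "K - {1} \<subseteq> {2..n}"
        by (auto simp: subset_iff Suc_le_eq numeral_2_eq_2)
      then have "K - {1} \<in> monomials {2..n} q"
        using K by (simp add: monomials_def)
      with * have "d_form n (m0_bracket n) \<omega> (insert 1 (K - {1})) = 0"
        by blast
      then show False
        using \<open>d_form n (m0_bracket n) \<omega> K \<noteq> 0\<close> K(3) by (simp add: insert_absorb)
    qed
  qed auto
  also have "\<dots> \<longleftrightarrow> (\<forall>L\<in>monomials {2..n} q.
      (\<Sum>j\<in>L. if 1 \<in> insert (Suc j) (L - {j}) then 0 else \<omega> (insert (Suc j) (L - {j}))) = 0)"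
    by (intro ball_cong refl) (simp only: eq eq2)
  also have "\<dots> \<longleftrightarrow> (\<lambda>I. if 1 \<in> I then 0 else \<omega> I) \<in> closed_forms n q"
    using sup by (simp only: closed_forms_def mem_Collect_eq simp_thms)
  finally show ?thesis .
qed

lemma cocycles_m0:
  "cocycles n (m0_bracket n) q = {\<omega> \<in> supported (monomials {1..n} q).
    (\<lambda>I. if 1 \<in> I then 0 else \<omega> I) \<in> closed_forms n q}"
  unfolding cocycles_def carrier_form_space using d_form_m0_closed_forms by blast

lemma additive_cocycles: "additive_set (cocycles n (m0_bracket n) q)"
  unfolding additive_set_def
proof (intro conjI ballI)
  show "(\<lambda>_. 0) \<in> cocycles n (m0_bracket n) q"
    by (auto simp: cocycles_def carrier_form_space supported_def d_form_m0)
  fix \<alpha> \<beta> assume "\<alpha> \<in> cocycles n (m0_bracket n) q" "\<beta> \<in> cocycles n (m0_bracket n) q"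
  then show "(\<lambda>I. \<alpha> I + \<beta> I) \<in> cocycles n (m0_bracket n) q"
    using additive_setD(2)[OF additive_supported]
    by (auto simp: cocycles_def carrier_form_space d_form_m0_add)
qed

lemma finite_cocycles: "finite (cocycles n (m0_bracket n) q)"
  unfolding cocycles_def carrier_form_space by simp

lemma closed_forms_0:
  assumes "\<omega> \<in> closed_forms n q" and "I \<notin> monomials {2..n} q"
  shows "\<omega> I = 0"
  using assms by (simp add: closed_forms_def supported_iff)

lemma closed_forms_no_1:
  assumes "\<omega> \<in> closed_forms n q" and "1 \<in> I"
  shows "\<omega> I = 0"
proof -
  have "I \<notin> monomials {2..n} q"
    using assms(2) by (auto simp: monomials_def)
  then show ?thesis
    by (rule closed_forms_0[OF assms(1)])
qed

text \<open>Dropping the monomials with e^1 maps the cocycles onto \<open>closed_forms\<close>; the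
  kernel consists of all q-forms divisible by e^1.\<close>

lemma card_cocycles_m0:
  "card (cocycles n (m0_bracket n) q) =
    card (closed_forms n q) * 2 ^ card {I \<in> monomials {1..n} q. 1 \<in> I}"
proof -
  let ?T = "\<lambda>\<omega> I. if 1 \<in> I then 0 else \<omega> I :: bit" and ?Z = "cocycles n (m0_bracket n) q"
  have zero: "(\<lambda>_. 0) \<in> closed_forms n q"
    by (auto simp: closed_forms_def supported_def)
  have ker: "{\<omega> \<in> ?Z. ?T \<omega> = (\<lambda>_. 0)} = supported {I \<in> monomials {1..n} q. 1 \<in> I}"
  proof (intro equalityI subsetI)
    fix \<omega> assume "\<omega> \<in> {\<omega> \<in> ?Z. ?T \<omega> = (\<lambda>_. 0)}"
    then have "\<omega> \<in> supported (monomials {1..n} q)" "\<forall>I. ?T \<omega> I = 0"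
      by (simp_all add: cocycles_m0 fun_eq_iff)
    then show "\<omega> \<in> supported {I \<in> monomials {1..n} q. 1 \<in> I}"
      by (auto simp: supported_iff split: if_splits)
  next
    fix \<omega> assume w: "\<omega> \<in> supported {I \<in> monomials {1..n} q. 1 \<in> I}"
    then have T: "?T \<omega> = (\<lambda>_. 0)"
      by (auto simp: supported_iff)
    have "\<omega> \<in> supported (monomials {1..n} q)"
      using w by (simp add: supported_iff)
    then show "\<omega> \<in> {\<omega> \<in> ?Z. ?T \<omega> = (\<lambda>_. 0)}"
      using zero by (simp only: cocycles_m0 T mem_Collect_eq simp_thms)
  qed
  have im: "?T ` ?Z = closed_forms n q"
  proof (intro equalityI subsetI)
    fix \<omega> assume w: "\<omega> \<in> closed_forms n q"
    then have "?T \<omega> = \<omega>"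
      using closed_forms_no_1 by auto
    moreover from w have "\<omega> \<in> supported (monomials {1..n} q)"
    proof -
      have "monomials {2..n} q \<subseteq> monomials {1..n} q"
        by (auto simp: monomials_def)
      from supported_mono[OF this] w show ?thesis
        by (auto simp: closed_forms_def)
    qed
    ultimately show "\<omega> \<in> ?T ` ?Z"
      using w by (intro image_eqI[of _ _ \<omega>]) (auto simp: cocycles_m0)
  qed (auto simp: cocycles_m0)
  have "card ?Z = card {\<omega> \<in> ?Z. ?T \<omega> = (\<lambda>_. 0)} * card (?T ` ?Z)"
    by (rule card_kernel_times_image[OF finite_cocycles additive_cocycles]) auto
  then show ?thesis
    unfolding ker im by (simp add: card_supported)
qed

lemma coboundaries_Suc:
  "coboundaries n br (Suc q) = d_form n br ` supported (monomials {1..n} q)"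
  by (simp add: coboundaries_def carrier_form_space)

text \<open>Coboundaries are divisible by e^1, and such forms are cocycles.\<close>

lemma coboundaries_subset_cocycles:
  "coboundaries n (m0_bracket n) (Suc q) \<subseteq> cocycles n (m0_bracket n) (Suc q)"
proof
  fix \<eta> assume "\<eta> \<in> coboundaries n (m0_bracket n) (Suc q)"
  then have \<eta>: "\<eta> \<in> supported {K \<in> monomials {1..n} (Suc q). 1 \<in> K}"
    using d_form_m0_supported by (auto simp: coboundaries_Suc)
  have T: "(\<lambda>I. if 1 \<in> I then 0 else \<eta> I) = (\<lambda>_. 0)"
    using \<eta> by (auto simp: supported_iff)
  have "(\<lambda>_. 0) \<in> closed_forms n (Suc q)"
    by (auto simp: closed_forms_def supported_def)
  moreover have "\<eta> \<in> supported (monomials {1..n} (Suc q))"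
    using \<eta> by (simp add: supported_iff)
  ultimately show "\<eta> \<in> cocycles n (m0_bracket n) (Suc q)"
    by (simp only: cocycles_m0 T mem_Collect_eq simp_thms)
qed

lemma additive_coboundaries: "additive_set (coboundaries n (m0_bracket n) (Suc q))"
  unfolding additive_set_def
proof (intro conjI ballI)
  show "(\<lambda>_. 0) \<in> coboundaries n (m0_bracket n) (Suc q)"
    unfolding coboundaries_Suc
    by (rule image_eqI[of _ _ "\<lambda>_. 0"]) (auto simp: d_form_m0 supported_def)
  fix \<alpha> \<beta>
  assume "\<alpha> \<in> coboundaries n (m0_bracket n) (Suc q)" "\<beta> \<in> coboundaries n (m0_bracket n) (Suc q)"
  then obtain \<alpha>' \<beta>' where "\<alpha>' \<in> supported (monomials {1..n} q)" "\<beta>' \<in> supported (monomials {1..n} q)"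
    "\<alpha> = d_form n (m0_bracket n) \<alpha>'" "\<beta> = d_form n (m0_bracket n) \<beta>'"
    by (auto simp: coboundaries_Suc)
  then show "(\<lambda>I. \<alpha> I + \<beta> I) \<in> coboundaries n (m0_bracket n) (Suc q)"
    unfolding coboundaries_Suc using additive_setD(2)[OF additive_supported, of \<alpha>' _ \<beta>']
    by (intro image_eqI[of _ _ "\<lambda>I. \<alpha>' I + \<beta>' I"]) (auto simp: d_form_m0_add)
qed

lemma card_coboundaries_m0:
  "2 ^ card (monomials {1..n} q) =
    card (cocycles n (m0_bracket n) q) * card (coboundaries n (m0_bracket n) (Suc q))"
proof -
  have "card (supported (monomials {1..n} q)) =
      card {\<omega> \<in> supported (monomials {1..n} q). d_form n (m0_bracket n) \<omega> = (\<lambda>_. 0)} *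
      card (d_form n (m0_bracket n) ` supported (monomials {1..n} q))"
    by (rule card_kernel_times_image[OF _ additive_supported d_form_m0_add]) simp
  then show ?thesis
    by (simp add: card_supported coboundaries_Suc cocycles_def carrier_form_space)
qed

lemma module_form_subspace:
  assumes "additive_set Z"
  shows "module (class_ring :: bit ring) ((form_space n q)\<lparr>carrier := Z\<rparr>)"
proof -
  have bit: "a = 0 \<or> a = 1" for a :: bit
    by (cases a) auto
  show ?thesis
  proof (intro Module.module.intro abelian_groupI)
    show "cring (class_ring :: bit ring)"
      using field_class_ring unfolding field_def domain_def by blast
    show "module_axioms (class_ring :: bit ring) ((form_space n q)\<lparr>carrier := Z\<rparr>)"
    proof (unfold module_axioms_def, safe)
      fix a :: bit and x assume "x \<in> carrier ((form_space n q)\<lparr>carrier := Z\<rparr>)"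
      then show "a \<odot>\<^bsub>(form_space n q)\<lparr>carrier := Z\<rparr>\<^esub> x \<in> carrier ((form_space n q)\<lparr>carrier := Z\<rparr>)"
        using bit[of a] additive_setD(1)[OF assms] by (auto simp: form_space_def)
    qed (simp_all add: form_space_def algebra_simps)
  next
    fix x assume "x \<in> carrier ((form_space n q)\<lparr>carrier := Z\<rparr>)"
    then show "\<exists>y\<in>carrier ((form_space n q)\<lparr>carrier := Z\<rparr>). y \<oplus>\<^bsub>(form_space n q)\<lparr>carrier := Z\<rparr>\<^esub> x =
        \<zero>\<^bsub>(form_space n q)\<lparr>carrier := Z\<rparr>\<^esub>"
      by (intro bexI[of _ x]) (auto simp: form_space_def)
  qed (use assms in \<open>auto simp: form_space_def additive_set_def ac_simps\<close>)
qed

lemma abelian_subgroup_form_subspace: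
  assumes Z: "additive_set Z" and W: "additive_set W" "W \<subseteq> Z"
  shows "abelian_subgroup W ((form_space n q)\<lparr>carrier := Z\<rparr>)"
proof (rule abelian_subgroupI3)
  let ?M = "(form_space n q)\<lparr>carrier := Z\<rparr>"
  interpret M: Module.module "class_ring :: bit ring" ?M
    by (rule module_form_subspace[OF Z])
  show "abelian_group ?M"
    by (rule M.abelian_group_axioms)
  have inv: "\<ominus>\<^bsub>?M\<^esub> a = a" if "a \<in> W" for a
    using that W(2) by (intro M.minus_equality) (auto simp: form_space_def)
  have add: "a \<oplus>\<^bsub>?M\<^esub> b \<in> W" if "a \<in> W" "b \<in> W" for a b
    using that additive_setD(2)[OF W(1)] by (simp add: form_space_def)
  have "W \<noteq> {}"
    using additive_setD(1)[OF W(1)] by blast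
  then show "additive_subgroup W ?M"
    using W(2) inv add by (intro additive_subgroup.intro M.add.subgroupI) simp_all
qed

section \<open>Counting the cohomology\<close>

lemma card_quotient_module:
  assumes "abelian_subgroup W M" and "finite (carrier M)"
  shows "card (carrier (quotient_module M W)) * card W = card (carrier M)"
proof -
  interpret abelian_subgroup W M by fact
  show ?thesis
    using add.lagrange[OF a_subgroup]
    by (simp add: quotient_module_def A_RCOSETS_def Coset.order_def)
qed

text \<open>Deleting 1 pairs the larger monomials containing 1 with the q-element ones avoiding
  it.\<close>

lemma card_monomials_with_1:
  assumes "n \<ge> 1"
  shows "card {I \<in> monomials {1..n} (Suc q). 1 \<in> I} + card {I \<in> monomials {1..n} q. 1 \<in> I} =
    card (monomials {1..n} q)"
proof -
  have "bij_betw (\<lambda>I. I - {1}) {I \<in> monomials {1..n} (Suc q). 1 \<in> I}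
      {I \<in> monomials {1..n} q. 1 \<notin> I}"
  proof (rule bij_betw_byWitness[where f' = "insert 1"])
    show "insert 1 ` {I \<in> monomials {1..n} q. 1 \<notin> I} \<subseteq> {I \<in> monomials {1..n} (Suc q). 1 \<in> I}"
      using assms by (auto simp: monomials_def card_insert_if finite_subset)
  qed (auto simp: monomials_def)
  then have "card {I \<in> monomials {1..n} (Suc q). 1 \<in> I} = card {I \<in> monomials {1..n} q. 1 \<notin> I}"
    by (rule bij_betw_same_card)
  also have "\<dots> + card {I \<in> monomials {1..n} q. 1 \<in> I} = card (monomials {1..n} q)"
    by (subst card_Un_disjoint[symmetric]) (auto intro!: arg_cong[of _ _ card])
  finally show ?thesis .
qed

lemma card_UNIV_bit: "card (UNIV :: bit set) = 2"
proof -
  have "(UNIV :: bit set) = {0, 1}"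
    using bit.exhaust by auto
  then show ?thesis
    by (metis card_2_iff zero_neq_one)
qed

text \<open>Lagrange for cocycles modulo coboundaries, and rank and nullity for d on q-forms,
  express the order of the cohomology by the two cocycle counts. The powers of 2 from forms
  divisible by e^1 cancel against the number of q-monomials.\<close>

theorem betti_m0:
  assumes "n \<ge> 1"
  shows "2 ^ betti n (m0_bracket n) (Suc q) = card (closed_forms n (Suc q)) * card (closed_forms n q)"
proof -
  let ?Z = "cocycles n (m0_bracket n)" and ?B = "coboundaries n (m0_bracket n) (Suc q)"
  let ?M = "(form_space n (Suc q))\<lparr>carrier := ?Z (Suc q)\<rparr>"
  let ?a = "\<lambda>q. card {I \<in> monomials {1..n} q. 1 \<in> I}"
  have sub: "abelian_subgroup ?B ?M"
    by (rule abelian_subgroup_form_subspace[OF additive_cocycles additive_coboundaries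
          coboundaries_subset_cocycles])
  interpret H: vectorspace "class_ring :: bit ring" "cohomology n (m0_bracket n) (Suc q)"
    unfolding cohomology_def
    by (rule vectorspace_quotient_module[OF module_form_subspace[OF additive_cocycles] sub])
  have card: "card (carrier (cohomology n (m0_bracket n) (Suc q))) * card ?B = card (?Z (Suc q))"
    unfolding cohomology_def using card_quotient_module[OF sub] finite_cocycles by simp
  have pos: "card (?Z r) > 0" for r
    unfolding card_gt_0_iff using finite_cocycles additive_setD(1)[OF additive_cocycles] by blast
  \<comment> \<open>An infinite carrier would have \<open>card\<close> equal to 0, against the
    positive number of cocycles.\<close>
  then have "finite (carrier (cohomology n (m0_bracket n) (Suc q)))"
    using card by (metis card.infinite mult_zero_left less_irrefl)
  then have "card (carrier (cohomology n (m0_bracket n) (Suc q))) = 2 ^ betti n (m0_bracket n) (Suc q)"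
    using H.card_carrier_eq_power_dim by (simp add: betti_def card_UNIV_bit)
  then have "2 ^ betti n (m0_bracket n) (Suc q) * 2 ^ card (monomials {1..n} q) =
      card (?Z (Suc q)) * card (?Z q)"
    using card card_coboundaries_m0[of n q] by simp
  also have "\<dots> = card (closed_forms n (Suc q)) * card (closed_forms n q) * 2 ^ (?a (Suc q) + ?a q)"
    by (simp add: card_cocycles_m0 power_add)
  also have "?a (Suc q) + ?a q = card (monomials {1..n} q)"
    by (rule card_monomials_with_1[OF assms])
  finally show ?thesis
    by simp
qed

section \<open>The kernel of the derivation in degrees 0 to 3\<close>

lemma card_closed_forms_0: "card (closed_forms n 0) = 2"
proof -
  have "L = {}" if "L \<in> monomials {2..n} 0" for L
    using that finite_subset[of L "{2..n}"] by (auto simp: monomials_def)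
  moreover have "{} \<in> monomials {2..n} 0"
    by (simp add: monomials_def)
  ultimately have "monomials {2..n} 0 = {{}}"
    by blast
  then have "closed_forms n 0 = supported {{}}"
    by (simp add: closed_forms_def)
  then show ?thesis
    by (simp add: card_supported)
qed

text \<open>The coefficient of D \<omega> at e^(i-1) is that of \<omega> at e^i, so only e^2
  survives.\<close>

lemma card_closed_forms_1:
  assumes "n \<ge> 2"
  shows "card (closed_forms n 1) = 2"
proof -
  have mono: "monomials {2..n} 1 = (\<lambda>i. {i}) ` {2..n}"
    by (auto simp: monomials_def card_1_singleton_iff)
  have "closed_forms n 1 = supported {{2}}"
  proof (intro equalityI subsetI)
    fix \<omega> assume "\<omega> \<in> closed_forms n 1"
    then have *: "\<omega> \<in> supported ((\<lambda>i. {i}) ` {2..n}) \<and>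
        (\<forall>L\<in>(\<lambda>i. {i}) ` {2..n}. (\<Sum>j\<in>L. \<omega> (insert (Suc j) (L - {j}))) = 0)"
      unfolding closed_forms_def mono mem_Collect_eq .
    note sup = conjunct1[OF *] and closed = conjunct2[OF *]
    show "\<omega> \<in> supported {{2}}"
      unfolding supported_iff
    proof (intro allI impI)
      fix I assume I: "I \<notin> {{2::nat}}"
      show "\<omega> I = 0"
      proof (cases "I \<in> (\<lambda>i. {i}) ` {2..n}")
        case True
        then obtain i where i: "I = {i}" "i \<in> {2..n}"
          by blast
        with I have "i - 1 \<in> {2..n}" "Suc (i - 1) = i"
          by (auto simp: le_less)
        then show ?thesis
          using bspec[OF closed, of "{i - 1}"] i by simp
      qed (rule supported_0[OF sup])
    qed
  next
    fix \<omega> :: form assume \<omega>: "\<omega> \<in> supported {{2}}"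
    have "{{2}} \<subseteq> (\<lambda>i. {i}) ` {2..n}"
      using assms by auto
    then have "\<omega> \<in> supported ((\<lambda>i. {i}) ` {2..n})"
      using \<omega> supported_mono by blast
    moreover have "\<omega> {Suc j} = 0" if "j \<in> {2..n}" for j
      using that by (intro supported_0[OF \<omega>]) auto
    ultimately show "\<omega> \<in> closed_forms n 1"
      unfolding closed_forms_def mono by auto
  qed
  then show ?thesis
    by (simp add: card_supported)
qed

lemma closed_forms_card:
  assumes "\<omega> \<in> closed_forms n q" and "card I \<noteq> q"
  shows "\<omega> I = 0"
proof -
  have "I \<notin> monomials {2..n} q"
    using assms(2) by (simp add: monomials_def)
  then show ?thesis
    by (rule closed_forms_0[OF assms(1)])
qed

lemma closed_forms_out:
  assumes "\<omega> \<in> closed_forms n q" and "i \<in> I" and "i > n"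
  shows "\<omega> I = 0"
proof -
  have "I \<notin> monomials {2..n} q"
    using assms(2,3) by (auto simp: monomials_def)
  then show ?thesis
    by (rule closed_forms_0[OF assms(1)])
qed

text \<open>In characteristic 2 a 2-form is a symmetric function of ordered index pairs that
  vanishes on the diagonal; indices are shifted by 2.\<close>

lemma card_closed_forms_2: "card (closed_forms (Suc N) 2) = card (closed2 N)"
proof -
  let ?\<Phi> = "\<lambda>\<omega> (i, j). \<omega> {i + 2, j + 2} :: bit"
  have ex: "\<exists>i j. L = {i + 2, j + 2} \<and> i \<noteq> j \<and> i < N \<and> j < N" if L: "L \<in> monomials {2..Suc N} 2" for L
  proof -
    obtain x y where xy: "L = {x, y}" "x \<noteq> y"
      using L by (auto simp: monomials_def card_2_iff)
    then have "x \<in> {2..Suc N}" "y \<in> {2..Suc N}"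
      using L by (auto simp: monomials_def)
    then obtain i j where "x = i + 2" "y = j + 2" "i < N" "j < N"
      using that[of "x - 2" "y - 2"] by auto
    with xy show ?thesis
      by blast
  qed
  have "bij_betw ?\<Phi> (closed_forms (Suc N) 2) (closed2 N)"
  proof (rule bij_betw_imageI)
    show "inj_on ?\<Phi> (closed_forms (Suc N) 2)"
    proof (intro inj_onI ext)
      fix \<alpha> \<beta> L
      assume \<alpha>: "\<alpha> \<in> closed_forms (Suc N) 2" and \<beta>: "\<beta> \<in> closed_forms (Suc N) 2" and eq: "?\<Phi> \<alpha> = ?\<Phi> \<beta>"
      show "\<alpha> L = \<beta> L"
      proof (cases "L \<in> monomials {2..Suc N} 2")
        case True
        then obtain i j where "L = {i + 2, j + 2}"
          using ex by blast
        then show ?thesis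
          using fun_cong[OF eq, of "(i, j)"] by simp
      next
        case False
        show ?thesis
          by (simp only: closed_forms_0[OF \<alpha> False] closed_forms_0[OF \<beta> False])
      qed
    qed
    show "?\<Phi> ` closed_forms (Suc N) 2 = closed2 N"
    proof (intro equalityI subsetI)
      fix c assume "c \<in> ?\<Phi> ` closed_forms (Suc N) 2"
      then obtain \<omega> where \<omega>: "\<omega> \<in> closed_forms (Suc N) 2" and c: "c = ?\<Phi> \<omega>"
        by auto
      note card0 = closed_forms_card[OF \<omega>] and out = closed_forms_out[OF \<omega>]
      have "\<omega> {Suc i + 2, j + 2} + \<omega> {i + 2, Suc j + 2} = 0" for i j
      proof -
        \<comment> \<open>Only distinct indices below \<open>N\<close> give a defining condition of
          \<open>closed_forms\<close>. On the diagonal the two terms coincide, and beyond the range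
          both vanish.\<close>
        consider "i = j" | "i \<noteq> j" "i < N" "j < N" | "i \<ge> N" | "j \<ge> N"
          by linarith
        then show ?thesis
        proof cases
          case 2
          then have "{i + 2, j + 2} \<in> monomials {2..Suc N} 2"
            by (auto simp: monomials_def)
          then have "(\<Sum>l\<in>{i + 2, j + 2}. \<omega> (insert (Suc l) ({i + 2, j + 2} - {l}))) = 0"
            using \<omega> by (auto simp: closed_forms_def)
          moreover have "{i + 2, j + 2} - {i + 2} = {j + 2}" "{i + 2, j + 2} - {j + 2} = {i + 2}"
            using 2 by auto
          ultimately show ?thesis
            using 2 by (simp add: insert_commute)
        next
          case 3
          then show ?thesis
            using out[of "Suc i + 2"] out[of "i + 2"] by simp
        next
          case 4
          then show ?thesis
            using out[of "Suc j + 2"] out[of "j + 2"] by simp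
        qed (simp add: insert_commute)
      qed
      then show "c \<in> closed2 N"
        unfolding closed2_def c by (auto simp: insert_commute intro: card0 out)
    next
      fix c assume "c \<in> closed2 N"
      then have sym: "c (i, j) = c (j, i)" and diag: "c (i, i) = 0"
        and zero: "i \<ge> N \<Longrightarrow> c (i, j) = 0" and closed: "c (Suc i, j) + c (i, Suc j) = 0" for i j
        unfolding closed2_def by blast+
      define \<omega> :: form where
        "\<omega> L = of_bool (\<exists>i j. L = {i + 2, j + 2} \<and> c (i, j) = 1)" for L
      have \<omega>: "\<omega> {i + 2, j + 2} = c (i, j)" for i j
      proof -
        have "(\<exists>i' j'. {i + 2, j + 2} = {i' + 2, j' + 2} \<and> c (i', j') = 1) \<longleftrightarrow> c (i, j) = 1"
          using sym by (auto simp: doubleton_eq_iff)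
        then show ?thesis
          unfolding \<omega>_def by (cases "c (i, j)") auto
      qed
      have "\<omega> \<in> supported (monomials {2..Suc N} 2)"
        unfolding supported_iff
      proof (intro allI impI)
        fix L assume L: "L \<notin> monomials {2..Suc N} 2"
        have "\<not> (L = {i + 2, j + 2} \<and> c (i, j) = 1)" for i j
        proof
          assume *: "L = {i + 2, j + 2} \<and> c (i, j) = 1"
          then have "i \<noteq> j" "i < N" "j < N"
            using diag zero[of i j] zero[of j i] sym[of i j] by (auto simp: not_le[symmetric])
          with * L show False
            by (auto simp: monomials_def)
        qed
        then show "\<omega> L = 0"
          by (simp add: \<omega>_def)
      qed
      moreover have "(\<Sum>l\<in>L. \<omega> (insert (Suc l) (L - {l}))) = 0" if L: "L \<in> monomials {2..Suc N} 2" for L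
      proof -
        obtain i j where ij: "L = {i + 2, j + 2}" "i \<noteq> j"
          using ex[OF L] by auto
        then have "L - {i + 2} = {j + 2}" "L - {j + 2} = {i + 2}"
          by auto
        then have "(\<Sum>l\<in>L. \<omega> (insert (Suc l) (L - {l}))) = \<omega> {Suc i + 2, j + 2} + \<omega> {i + 2, Suc j + 2}"
          using ij by (simp add: insert_commute)
        then show ?thesis
          by (simp only: \<omega> closed)
      qed
      ultimately have "\<omega> \<in> closed_forms (Suc N) 2"
        by (simp add: closed_forms_def)
      moreover have "?\<Phi> \<omega> = c"
        using \<omega> by (auto simp del: add_2_eq_Suc')
      ultimately show "c \<in> ?\<Phi> ` closed_forms (Suc N) 2"
        by blast
    qed
  qed
  then show ?thesis
    by (rule bij_betw_same_card)
qed

lemma card_closed_forms_3: "card (closed_forms (Suc N) 3) = card (closed3 N)"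
proof -
  let ?\<Phi> = "\<lambda>\<omega> (i, j, k). \<omega> {i + 2, j + 2, k + 2} :: bit"
  have ex: "\<exists>i j k. L = {i + 2, j + 2, k + 2} \<and> i \<noteq> j \<and> i \<noteq> k \<and> j \<noteq> k \<and> i < N \<and> j < N \<and> k < N"
    if L: "L \<in> monomials {2..Suc N} 3" for L
  proof -
    obtain x y z where xyz: "L = {x, y, z}" "x \<noteq> y" "x \<noteq> z" "y \<noteq> z"
      using L by (auto simp: monomials_def card_3_iff)
    then have "x \<in> {2..Suc N}" "y \<in> {2..Suc N}" "z \<in> {2..Suc N}"
      using L by (auto simp: monomials_def)
    then obtain i j k where "x = i + 2" "y = j + 2" "z = k + 2" "i < N" "j < N" "k < N"
      using that[of "x - 2" "y - 2" "z - 2"] by auto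
    with xyz show ?thesis
      by blast
  qed
  have diff: "{i + 2, j + 2, k + 2} - {i + 2} = {j + 2, k + 2}"
    "{i + 2, j + 2, k + 2} - {j + 2} = {i + 2, k + 2}"
    "{i + 2, j + 2, k + 2} - {k + 2} = {i + 2, j + 2}"
    if "i \<noteq> j" "i \<noteq> k" "j \<noteq> k" for i j k :: nat
    using that by auto
  have sum: "(\<Sum>l\<in>{i + 2, j + 2, k + 2}. \<omega> (insert (Suc l) ({i + 2, j + 2, k + 2} - {l}))) =
      \<omega> {Suc i + 2, j + 2, k + 2} + \<omega> {i + 2, Suc j + 2, k + 2} + \<omega> {i + 2, j + 2, Suc k + 2}"
    if ne: "i \<noteq> j" "i \<noteq> k" "j \<noteq> k" for i j k and \<omega> :: form
  proof -
    have "(\<Sum>l\<in>{i + 2, j + 2, k + 2}. \<omega> (insert (Suc l) ({i + 2, j + 2, k + 2} - {l}))) =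
        \<omega> (insert (Suc i + 2) {j + 2, k + 2}) + (\<omega> (insert (Suc j + 2) {i + 2, k + 2}) +
        \<omega> (insert (Suc k + 2) {i + 2, j + 2}))"
      using ne by (subst sum.insert, simp, simp, subst sum.insert, simp, simp, subst sum.insert,
          simp, simp, unfold diff[OF ne]) simp
    then show ?thesis
      by (simp only: insert_commute add.assoc)
  qed
  have "bij_betw ?\<Phi> (closed_forms (Suc N) 3) (closed3 N)"
  proof (rule bij_betw_imageI)
    show "inj_on ?\<Phi> (closed_forms (Suc N) 3)"
    proof (intro inj_onI ext)
      fix \<alpha> \<beta> L
      assume \<alpha>: "\<alpha> \<in> closed_forms (Suc N) 3" and \<beta>: "\<beta> \<in> closed_forms (Suc N) 3" and eq: "?\<Phi> \<alpha> = ?\<Phi> \<beta>"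
      show "\<alpha> L = \<beta> L"
      proof (cases "L \<in> monomials {2..Suc N} 3")
        case True
        then obtain i j k where "L = {i + 2, j + 2, k + 2}"
          using ex by blast
        then show ?thesis
          using fun_cong[OF eq, of "(i, j, k)"] by simp
      next
        case False
        show ?thesis
          by (simp only: closed_forms_0[OF \<alpha> False] closed_forms_0[OF \<beta> False])
      qed
    qed
    show "?\<Phi> ` closed_forms (Suc N) 3 = closed3 N"
    proof (intro equalityI subsetI)
      fix c assume "c \<in> ?\<Phi> ` closed_forms (Suc N) 3"
      then obtain \<omega> where \<omega>: "\<omega> \<in> closed_forms (Suc N) 3" and c: "c = ?\<Phi> \<omega>"
        by auto
      have out: "x > Suc N \<or> y > Suc N \<or> z > Suc N \<Longrightarrow> \<omega> {x, y, z} = 0" for x y z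
        using closed_forms_out[OF \<omega>, of _ "{x, y, z}"] by blast
      have card2: "\<omega> {x, y} = 0" for x y
        by (rule closed_forms_card[OF \<omega>]) (simp add: card_insert_if)
      have closed: "\<omega> {Suc i + 2, j + 2, k + 2} + \<omega> {i + 2, Suc j + 2, k + 2} +
          \<omega> {i + 2, j + 2, Suc k + 2} = 0" for i j k
      proof -
        consider "i = j" | "i = k" | "j = k" | "i \<noteq> j" "i \<noteq> k" "j \<noteq> k" "i < N" "j < N" "k < N"
          | "i \<ge> N \<or> j \<ge> N \<or> k \<ge> N"
          by linarith
        then show ?thesis
        proof cases
          case 4
          then have "{i + 2, j + 2, k + 2} \<in> monomials {2..Suc N} 3"
            by (auto simp: monomials_def)
          then show ?thesis
            using \<omega> by (simp only: sum[OF 4(1-3), symmetric] closed_forms_def mem_Collect_eq)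
        next
          case 5
          then have "\<omega> {Suc i + 2, j + 2, k + 2} = 0" "\<omega> {i + 2, Suc j + 2, k + 2} = 0"
            "\<omega> {i + 2, j + 2, Suc k + 2} = 0"
            by (auto intro!: out)
          then show ?thesis
            by simp
        qed (simp_all add: insert_commute card2)
      qed
      show "c \<in> closed3 N"
        unfolding c
        by (rule closed3I) (simp_all only: prod.case closed, simp_all add: insert_commute card2 out)
    next
      fix c assume c: "c \<in> closed3 N"
      define \<omega> :: form where
        "\<omega> L = of_bool (\<exists>i j k. L = {i + 2, j + 2, k + 2} \<and> c (i, j, k) = 1)" for L
      have \<omega>: "\<omega> {i + 2, j + 2, k + 2} = c (i, j, k)" for i j k
      proof -
        have "c (i, j, k) = 1"
          if eq: "{i + 2, j + 2, k + 2} = {i' + 2, j' + 2, k' + 2}" and 1: "c (i', j', k') = 1" for i' j' k'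
        proof -
          \<comment> \<open>A nonzero value forces distinct indices, so the two listings of the set
            differ by one of six permutations, under which \<open>c\<close> is invariant.\<close>
          have "i' \<noteq> j'" "i' \<noteq> k'" "j' \<noteq> k'"
            using 1 closed3_diag[OF c] by auto
          moreover have "i' \<in> {i, j, k}" "j' \<in> {i, j, k}" "k' \<in> {i, j, k}"
          proof -
            have "i' + 2 \<in> {i + 2, j + 2, k + 2}" "j' + 2 \<in> {i + 2, j + 2, k + 2}"
              "k' + 2 \<in> {i + 2, j + 2, k + 2}"
              unfolding eq by simp_all
            then show "i' \<in> {i, j, k}" "j' \<in> {i, j, k}" "k' \<in> {i, j, k}"
              by simp_all
          qed
          ultimately consider "i' = i" "j' = j" "k' = k" | "i' = i" "j' = k" "k' = j"
            | "i' = j" "j' = i" "k' = k" | "i' = j" "j' = k" "k' = i"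
            | "i' = k" "j' = i" "k' = j" | "i' = k" "j' = j" "k' = i"
            by auto
          then show ?thesis
            using 1 closed3_swap[OF c] by cases metis+
        qed
        then have "(\<exists>i' j' k'. {i + 2, j + 2, k + 2} = {i' + 2, j' + 2, k' + 2} \<and> c (i', j', k') = 1)
            \<longleftrightarrow> c (i, j, k) = 1"
          by blast
        then show ?thesis
          unfolding \<omega>_def by (cases "c (i, j, k)") auto
      qed
      have "\<omega> \<in> supported (monomials {2..Suc N} 3)"
        unfolding supported_iff
      proof (intro allI impI)
        fix L assume L: "L \<notin> monomials {2..Suc N} 3"
        have "\<not> (L = {i + 2, j + 2, k + 2} \<and> c (i, j, k) = 1)" for i j k
        proof
          assume *: "L = {i + 2, j + 2, k + 2} \<and> c (i, j, k) = 1"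
          then have "i \<noteq> j" "i \<noteq> k" "j \<noteq> k" "i < N" "j < N" "k < N"
            using closed3_diag[OF c] closed3_out[OF c] by (auto simp: not_le[symmetric])
          with * L show False
            by (auto simp: monomials_def)
        qed
        then show "\<omega> L = 0"
          by (simp add: \<omega>_def)
      qed
      moreover have "(\<Sum>l\<in>L. \<omega> (insert (Suc l) (L - {l}))) = 0" if L: "L \<in> monomials {2..Suc N} 3" for L
      proof -
        obtain i j k where L: "L = {i + 2, j + 2, k + 2}" and ne: "i \<noteq> j" "i \<noteq> k" "j \<noteq> k"
          using ex[OF L] by auto
        show ?thesis
          unfolding L sum[OF ne] \<omega> by (rule closed3D(5)[OF c])
      qed
      ultimately have "\<omega> \<in> closed_forms (Suc N) 3"
        by (simp add: closed_forms_def)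
      moreover have "?\<Phi> \<omega> = c"
        using \<omega> by (auto simp del: add_2_eq_Suc')
      ultimately show "c \<in> ?\<Phi> ` closed_forms (Suc N) 3"
        by blast
    qed
  qed
  then show ?thesis
    by (rule bij_betw_same_card)
qed

section \<open>The three Betti numbers\<close>

theorem theorem2:
  fixes n p m :: nat
  assumes "n \<ge> 3" and "n = 2 ^ p + m" and "0 < m" and "m \<le> 2 ^ p"
  shows "betti n (m0_bracket n) 1 = 2 \<and>
         int (betti n (m0_bracket n) 2) = \<lfloor>(1 / 2) * (real n + 1)\<rfloor> \<and>
         real (betti n (m0_bracket n) 3) =
           (1 / 3) * (2 ^ p - 1) * (2 ^ (p - 1) - 1) + (1 / 2) * real m * (real m - 1)
           + of_int \<lfloor>(1 / 2) * (real n - 1)\<rfloor>"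
proof (intro conjI)
  obtain N where N: "n = Suc N"
    using assms(1) by (cases n) auto
  let ?b = "betti n (m0_bracket n)"
  have pow: "a = b" if "(2::nat) ^ a = 2 ^ b" for a b :: nat
    using that by simp
  have b: "2 ^ ?b (Suc q) = card (closed_forms n (Suc q)) * card (closed_forms n q)" for q
    using betti_m0 assms(1) by simp
  have c0: "card (closed_forms n 0) = 2 ^ 1" and c1: "card (closed_forms n (Suc 0)) = 2 ^ 1"
    and c2: "card (closed_forms n 2) = 2 ^ (N div 2)"
    using card_closed_forms_0 card_closed_forms_1[of n] card_closed_forms_2[of N] card_closed2[of N]
      assms(1) by (simp_all add: N)
  show "?b 1 = 2"
    by (rule pow) (use b[of 0] c0 c1 in simp)
  have "?b 2 = N div 2 + 1"
    by (rule pow) (use b[of 1] c1 c2 in \<open>simp add: numeral_2_eq_2\<close>)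
  moreover have "\<lfloor>(1 / 2) * (real n + 1)\<rfloor> = (int n + 1) div 2"
    using floor_divide_of_int_eq[of "int n + 1" 2, where ?'a = real] by simp
  ultimately show "int (?b 2) = \<lfloor>(1 / 2) * (real n + 1)\<rfloor>"
    by (simp add: N)
  obtain e where e: "card (closed3 (2 ^ p + m - 1)) = 2 ^ e"
    "6 * int e = (2 ^ p - 1) * (2 ^ p - 2) + 3 * int m * (int m - 1)"
    using card_closed3[OF assms(4)] by blast
  have c3: "card (closed_forms n 3) = 2 ^ e"
    using card_closed_forms_3[of N] e(1) assms(2) N by (metis diff_Suc_1)
  have b3: "?b 3 = e + N div 2"
    by (rule pow) (use b[of 2] c2 c3 in \<open>simp add: power_add\<close>)
  \<comment> \<open>For p = 0 the bound m <= 1 would give n <= 2. A positive \<open>p\<close> makes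
    \<open>p - 1\<close> genuine, and 2^p - 2 = 2(2^(p-1) - 1) turns the factor 1/6 into
    1/3.\<close>
  have "p \<noteq> 0"
    using assms by (intro notI) simp
  then obtain r where r: "p = Suc r"
    using not0_implies_Suc by blast
  have "6 * real e = (2 ^ p - 1) * (2 ^ p - 2) + 3 * real m * (real m - 1)"
    using arg_cong[OF e(2), of real_of_int] by simp
  then have "real e = (1 / 3) * (2 ^ p - 1) * (2 ^ (p - 1) - 1) + (1 / 2) * real m * (real m - 1)"
    by (simp add: r field_simps)
  moreover have "\<lfloor>(1 / 2) * (real n - 1)\<rfloor> = int (N div 2)"
    using floor_divide_of_int_eq[of "int N" 2, where ?'a = real] by (simp add: N zdiv_int)
  ultimately show "real (?b 3) = (1 / 3) * (2 ^ p - 1) * (2 ^ (p - 1) - 1) +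
      (1 / 2) * real m * (real m - 1) + of_int \<lfloor>(1 / 2) * (real n - 1)\<rfloor>"
    by (simp only: b3 of_nat_add of_int_of_nat_eq)
qed

end
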